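(* Let $1\le p<\frac{n}{n-1}$. There is a constant $C_0>0$ depending only on $n$, $p$ and $\|J_X\|_{L^\infty(\Theta)}$ (the geometric data $\Omega,\Theta,X$ being fixed) such that for every $F\in L^p(\Theta)^n$, every $\varepsilon>0$ and every continuous function $\delta^\varepsilon:\mathbb{R}^n\to\mathbb{R}$ with $\operatorname{supp}\delta^\varepsilon\subset B(0,K\varepsilon)$ (for some $K>0$), $$\|f-f^\varepsilon\|_{W^{-1,p}}\le C_0\|F\|_{L^p(\Theta)}\left[\left|1-\int_{\mathbb{R}^n}\delta^\varepsilon(y)\,dy\right|+\|\rho\,\delta^\varepsilon\|_{L^p(\mathbb{R}^n)}\right],$$ where $\rho(x)=x$.
   Context: Geometry (fixed throughout). $\Omega\subset\mathbb{R}^n$, $n\in\{2,3\}$, is a (bounded) polyhedral domain with boundary $\partial\Omega$. It is divided into two disjoint components $\Omega_0,\Omega_1$ by a simple closed curve ($n=2$) or closed surface ($n=3$) $\Gamma$ (the immersed boundary), parametrized as $\Gamma=\{X(\theta)=(X_1(\theta),\dots,X_n(\theta)) : \theta\in\Theta\}$, where $\Theta\subset\mathbb{R}^{n-1}$ is bounded. Define $J_X=\sqrt{|\partial X_1/\partial\theta|^2+|\partial X_2/\partial\theta|^2}$ if $n=2$, and $J_X=\sqrt{\left|\frac{\partial(X_2,X_3)}{\partial(\theta_1,\theta_2)}\right|^2+\left|\frac{\partial(X_3,X_1)}{\partial(\theta_1,\theta_2)}\right|^2+\left|\frac{\partial(X_1,X_2)}{\partial(\theta_1,\theta_2)}\right|^2}$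 if $n=3$. Standing assumptions: $\Gamma$ is a $C^1$ boundary and $X$ is a $C^1$ function; $\operatorname{dist}(\Gamma,\partial\Omega)>0$; $J_X(\theta)\ne0$ for $\theta\in\Theta$. Notation. $p'$ is the conjugate exponent of $p$. $W^{1,s}_0(\Omega)=\{v\in W^{1,s}(\Omega): v|_{\partial\Omega}=0\}$; $W^{-1,p}(\Omega)^n$ is the topological dual of $W^{1,p'}_0(\Omega)^n$, with dual norm $\|\cdot\|_{W^{-1,p}}$. $B(a,r)=\{x\in\mathbb{R}^n:|x-a|<r\}$. $\|\rho\delta^\varepsilon\|_{L^p(\mathbb{R}^n)}=\left(\int_{\mathbb{R}^n}|y|^p|\delta^\varepsilon(y)|^p\,dy\right)^{1/p}$. Forces. $f\in W^{-1,p}(\Omega)^n$ is the functional $\langle f,\varphi\rangle=\int_\Theta F(\theta)\cdot\varphi(X(\theta))\,d\theta$, $\varphi\in W^{1,p'}_0(\Omega)^n$ (note $p'>n$, so $\varphi$ has a continuous representative). The regularized force is the function $f^\varepsilon(x)=\int_\Theta F(\theta)\,\delta^\varepsilon(x-X(\theta))\,d\theta$, $x\in\Omega$, identified with the functional $\varphi\mapsto\int_\Omega f^\varepsilon\cdot\varphi\,dx$. *)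

theory Defs
  imports "HOL-Analysis.Analysis" "HOL-Probability.Essential_Supremum"
begin

section \<open>Lebesgue spaces\<close>

text \<open>Exponents range over \<open>[1, \<infinity>]\<close>, represented by \<^typ>\<open>ennreal\<close>. Elements are functions, not
  equivalence classes modulo null sets.\<close>

definition Linf_norm :: "'a measure \<Rightarrow> ('a \<Rightarrow> 'b::euclidean_space) \<Rightarrow> ennreal" where
  "Linf_norm M f = esssup M (\<lambda>x. ennreal (norm (f x)))"

definition Lp_space :: "ennreal \<Rightarrow> 'a measure \<Rightarrow> ('a \<Rightarrow> 'b::euclidean_space) set" where
  "Lp_space s M = {f \<in> borel_measurable M.
     if s = \<infinity> then Linf_norm M f < \<infinity>
     else integrable M (\<lambda>x. norm (f x) powr enn2real s)}"

definition Lp_norm :: "ennreal \<Rightarrow> 'a measure \<Rightarrow> ('a \<Rightarrow> 'b::euclidean_space) \<Rightarrow> real" where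
  "Lp_norm s M f =
     (if s = \<infinity> then enn2real (Linf_norm M f)
      else (LINT x|M. norm (f x) powr enn2real s) powr (1 / enn2real s))"

definition conj_exponent :: "real \<Rightarrow> ennreal" where
  "conj_exponent p = (if p = 1 then \<infinity> else ennreal (p / (p - 1)))"

lemma conj_exponent_works:
  assumes "1 \<le> p"
  shows "inverse (ennreal p) + inverse (conj_exponent p) = 1"
proof (cases "p = 1")
  case True
  then show ?thesis by (simp add: conj_exponent_def)
next
  case False
  with assms have "p > 1" by simp
  then have "inverse (ennreal p) + inverse (conj_exponent p)
      = ennreal (inverse p) + ennreal (inverse (p / (p - 1)))"
    by (simp add: conj_exponent_def inverse_ennreal)
  also have "\<dots> = ennreal (inverse p + inverse (p / (p - 1)))"
    using \<open>p > 1\<close> by (simp add: ennreal_plus)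
  also have "inverse p + inverse (p / (p - 1)) = 1"
    using \<open>p > 1\<close> by (simp add: field_simps)
  finally show ?thesis by simp
qed


section \<open>Weak derivatives and Sobolev spaces\<close>

definition partial_deriv :: "'n \<Rightarrow> (real^'n \<Rightarrow> real) \<Rightarrow> real^'n \<Rightarrow> real" where
  "partial_deriv i f x = frechet_derivative f (at x) (axis i 1)"

primrec Ck_fun :: "nat \<Rightarrow> (real^'n \<Rightarrow> real) \<Rightarrow> bool" where
  "Ck_fun 0 f \<longleftrightarrow> continuous_on UNIV f"
| "Ck_fun (Suc k) f \<longleftrightarrow> (\<forall>x. f differentiable (at x)) \<and> (\<forall>i. Ck_fun k (partial_deriv i f))"

text \<open>The space \<open>C\<^sub>c\<^sup>\<infinity>(\<Omega>)\<close>, each element being extended by zero to the whole space.\<close>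

definition test_functions :: "(real^'n) set \<Rightarrow> (real^'n \<Rightarrow> real) set" where
  "test_functions \<Omega> = {\<psi>. (\<forall>k. Ck_fun k \<psi>) \<and>
     compact (closure {x. \<psi> x \<noteq> 0}) \<and> closure {x. \<psi> x \<noteq> 0} \<subseteq> \<Omega>}"

text \<open>\<open>G x $ k $ i\<close> is the weak partial derivative of the \<open>k\<close>-th component of \<open>\<phi>\<close> in direction \<open>i\<close>.
  Local integrability of \<open>\<phi>\<close> and \<open>G\<close> is not repeated here: below both are in \<open>L\<^sup>s(\<Omega>)\<close>, \<open>s \<ge> 1\<close>.\<close>

definition weak_jacobian :: "(real^'n) set \<Rightarrow> (real^'n \<Rightarrow> real^'k) \<Rightarrow> (real^'n \<Rightarrow> real^'n^'k) \<Rightarrow> bool" where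
  "weak_jacobian \<Omega> \<phi> G \<longleftrightarrow> (\<forall>k i. \<forall>\<psi>\<in>test_functions \<Omega>.
     (LINT x|lebesgue_on \<Omega>. \<phi> x $ k * partial_deriv i \<psi> x) =
     - (LINT x|lebesgue_on \<Omega>. G x $ k $ i * \<psi> x))"

definition W1 :: "ennreal \<Rightarrow> (real^'n) set \<Rightarrow> (real^'n \<Rightarrow> real^'k) set" where
  "W1 s \<Omega> = {\<phi> \<in> Lp_space s (lebesgue_on \<Omega>).
     \<exists>G \<in> Lp_space s (lebesgue_on \<Omega>). weak_jacobian \<Omega> \<phi> G}"

text \<open>The choice of \<open>G\<close> is immaterial, since weak derivatives are unique almost everywhere. The
  norm on \<open>real^'n^'k\<close> is the Frobenius norm.\<close>

definition W1_norm :: "ennreal \<Rightarrow> (real^'n) set \<Rightarrow> (real^'n \<Rightarrow> real^'k) \<Rightarrow> real" where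
  "W1_norm s \<Omega> \<phi> = Lp_norm s (lebesgue_on \<Omega>) \<phi> +
     Lp_norm s (lebesgue_on \<Omega>)
       (SOME G. G \<in> Lp_space s (lebesgue_on \<Omega>) \<and> weak_jacobian \<Omega> \<phi> G)"

text \<open>The trace of \<open>\<phi>\<close> on the boundary is that of its continuous representative on the closure of
  \<open>\<Omega>\<close>. This reading of \<open>\<phi> = 0\<close> on the boundary is the appropriate one for exponents \<open>s\<close> larger
  than the dimension, the only ones used here.\<close>

definition continuous_version :: "(real^'n) set \<Rightarrow> (real^'n \<Rightarrow> real^'k) \<Rightarrow> (real^'n \<Rightarrow> real^'k) \<Rightarrow> bool" where
  "continuous_version \<Omega> \<phi> w \<longleftrightarrow>
     continuous_on (closure \<Omega>) w \<and> (AE x in lebesgue_on \<Omega>. \<phi> x = w x)"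

definition cont_rep :: "(real^'n) set \<Rightarrow> (real^'n \<Rightarrow> real^'k) \<Rightarrow> real^'n \<Rightarrow> real^'k" where
  "cont_rep \<Omega> \<phi> = (SOME w. continuous_version \<Omega> \<phi> w)"

definition W1_0 :: "ennreal \<Rightarrow> (real^'n) set \<Rightarrow> (real^'n \<Rightarrow> real^'k) set" where
  "W1_0 s \<Omega> = {\<phi> \<in> W1 s \<Omega>. \<exists>w. continuous_version \<Omega> \<phi> w \<and> (\<forall>x\<in>frontier \<Omega>. w x = 0)}"

text \<open>The norm of \<open>W\<^sup>-\<^sup>1\<^sup>,\<^sup>p(\<Omega>)\<^sup>n\<close>. It is extended-valued, so that a finite bound on it also asserts
  boundedness of the functional.\<close>

definition Wneg1_norm :: "real \<Rightarrow> (real^'n) set \<Rightarrow> ((real^'n \<Rightarrow> real^'n) \<Rightarrow> real) \<Rightarrow> ennreal" where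
  "Wneg1_norm p \<Omega> L =
     (SUP \<phi> \<in> {\<phi> \<in> W1_0 (conj_exponent p) \<Omega>. W1_norm (conj_exponent p) \<Omega> \<phi> \<le> 1}. ennreal \<bar>L \<phi>\<bar>)"


section \<open>Geometry\<close>

definition polyhedral_domain :: "(real^'n) set \<Rightarrow> bool" where
  "polyhedral_domain \<Omega> \<longleftrightarrow> \<Omega> \<noteq> {} \<and> connected \<Omega> \<and>
     (\<exists>\<T>. finite \<T> \<and> (\<forall>T\<in>\<T>. polytope T) \<and> \<Omega> = interior (\<Union>\<T>))"

text \<open>Being \<open>C\<^sup>1\<close> on a set that need not be open means having a \<open>C\<^sup>1\<close> extension to a neighbourhood.
  The functions here are total, and the extension is the function itself.\<close>

definition C1_on :: "('a::real_normed_vector \<Rightarrow> 'b::real_normed_vector) \<Rightarrow> 'a set \<Rightarrow> bool" where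
  "C1_on f S \<longleftrightarrow> (\<exists>U D. open U \<and> S \<subseteq> U \<and>
     (\<forall>x\<in>U. (f has_derivative blinfun_apply (D x)) (at x)) \<and> continuous_on U D)"

text \<open>Locally, \<open>\<Gamma>\<close> is the graph of a \<open>C\<^sup>1\<close> function over a hyperplane with unit normal \<open>\<nu>\<close>; only the
  values of \<open>\<gamma>\<close> on that hyperplane matter.\<close>

definition C1_boundary :: "(real^'n) set \<Rightarrow> bool" where
  "C1_boundary \<Gamma> \<longleftrightarrow> (\<forall>a\<in>\<Gamma>. \<exists>r>0. \<exists>\<nu> (\<gamma> :: real^'n \<Rightarrow> real). norm \<nu> = 1 \<and> C1_on \<gamma> UNIV \<and>
     \<Gamma> \<inter> ball a r = {x \<in> ball a r. x \<bullet> \<nu> = \<gamma> (x - (x \<bullet> \<nu>) *\<^sub>R \<nu>)})"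

definition simple_closed_curve :: "'a::topological_space set \<Rightarrow> bool" where
  "simple_closed_curve \<Gamma> \<longleftrightarrow>
     (\<exists>g. simple_path g \<and> pathfinish g = pathstart g \<and> path_image g = \<Gamma>)"

definition closed_surface :: "'a::topological_space set \<Rightarrow> bool" where
  "closed_surface \<Gamma> \<longleftrightarrow> \<Gamma> \<noteq> {} \<and> compact \<Gamma> \<and> connected \<Gamma> \<and>
     (\<forall>x\<in>\<Gamma>. \<exists>V. openin (top_of_set \<Gamma>) V \<and> x \<in> V \<and> V homeomorphic (UNIV :: (real^2) set))"

text \<open>Determinant, up to sign, of the matrix \<open>A\<close> with row \<open>k\<close> deleted. Only its square is used, which
  does not depend on how the remaining rows are enumerated.\<close>

definition row_minor :: "real^'m^'n \<Rightarrow> 'n \<Rightarrow> real" where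
  "row_minor A k =
     (let \<sigma> = (SOME \<sigma> :: 'm \<Rightarrow> 'n. bij_betw \<sigma> UNIV (UNIV - {k})) in det (\<chi> i. A $ \<sigma> i))"

definition surface_factor :: "(real^'m \<Rightarrow> real^'n) \<Rightarrow> real^'m \<Rightarrow> real" where
  "surface_factor X \<theta> = sqrt (\<Sum>k\<in>UNIV. (row_minor (jacobian X (at \<theta>)) k)\<^sup>2)"

lemma row_minor_square:
  fixes A :: "real^'m^'n" and \<sigma> :: "'m \<Rightarrow> 'n"
  assumes \<sigma>: "bij_betw \<sigma> UNIV (UNIV - {k})"
  shows "(row_minor A k)\<^sup>2 = (det (\<chi> i. A $ \<sigma> i))\<^sup>2"
proof -
  define \<tau> where "\<tau> = (SOME \<sigma> :: 'm \<Rightarrow> 'n. bij_betw \<sigma> UNIV (UNIV - {k}))"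
  have \<tau>: "bij_betw \<tau> UNIV (UNIV - {k})"
    unfolding \<tau>_def using \<sigma> by (rule someI[where P = "\<lambda>\<sigma>. bij_betw \<sigma> UNIV (UNIV - {k})"])
  define \<pi> where "\<pi> = inv_into UNIV \<sigma> \<circ> \<tau>"
  have "bij_betw \<pi> UNIV UNIV"
    unfolding \<pi>_def using \<tau> bij_betw_inv_into[OF \<sigma>] by (rule bij_betw_trans)
  then have \<pi>: "\<pi> permutes UNIV"
    by (rule bij_imp_permutes) simp
  have "\<sigma> (\<pi> i) = \<tau> i" for i
    using \<sigma> \<tau> bij_betw_inv_into_right[OF \<sigma>, of "\<tau> i"] bij_betwE[OF \<tau>] by (simp add: \<pi>_def)
  then have eq: "(\<chi> i. A $ \<tau> i) = (\<chi> i. (\<chi> i. A $ \<sigma> i) $ \<pi> i)"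
    by (simp add: vec_eq_iff)
  have "det (\<chi> i. A $ \<tau> i) = of_int (sign \<pi>) * det (\<chi> i. A $ \<sigma> i)"
    unfolding eq by (rule det_permute_rows[OF \<pi>])
  moreover have "(of_int (sign \<pi>) :: real)\<^sup>2 = 1"
    by (simp add: sign_def)
  ultimately show ?thesis
    by (simp add: row_minor_def \<tau>_def[symmetric] power_mult_distrib)
qed

lemma surface_factor_2:
  fixes X :: "real^1 \<Rightarrow> real^2"
  defines "D \<equiv> \<lambda>\<theta>. jacobian X (at \<theta>)"
  shows "surface_factor X \<theta> = sqrt (\<bar>D \<theta> $ 1 $ 1\<bar>\<^sup>2 + \<bar>D \<theta> $ 2 $ 1\<bar>\<^sup>2)"
proof -
  have U: "(UNIV :: 2 set) = {1, 2}" by (simp add: UNIV_2)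
  have "bij_betw (\<lambda>_::1. 2::2) UNIV (UNIV - {1})" "bij_betw (\<lambda>_::1. 1::2) UNIV (UNIV - {2})"
    by (auto simp: bij_betw_def inj_on_def U)
  from this[THEN row_minor_square, of "D \<theta>"] show ?thesis
    by (simp add: surface_factor_def D_def sum_2 det_1)
qed

lemma surface_factor_3:
  fixes X :: "real^2 \<Rightarrow> real^3"
  defines "D \<equiv> \<lambda>\<theta>. jacobian X (at \<theta>)"
  defines "d \<equiv> \<lambda>\<theta> i j. D \<theta> $ i $ 1 * D \<theta> $ j $ 2 - D \<theta> $ i $ 2 * D \<theta> $ j $ 1"
  shows "surface_factor X \<theta> = sqrt (\<bar>d \<theta> 2 3\<bar>\<^sup>2 + \<bar>d \<theta> 3 1\<bar>\<^sup>2 + \<bar>d \<theta> 1 2\<bar>\<^sup>2)"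
proof -
  have ne: "(1::3) \<noteq> 2" "(1::3) \<noteq> 3" "(2::3) \<noteq> 3" "(1::2) \<noteq> 2" by simp_all
  have U3: "(UNIV :: 3 set) = {1, 2, 3}" by (rule UNIV_3)
  have U2: "(UNIV :: 2 set) = {1, 2}" by (rule UNIV_2)
  have bij: "bij_betw (\<lambda>i::2. if i = 1 then a else b) UNIV (UNIV - {c})"
    if "a \<noteq> b" "UNIV - {c} = {a, b}" for a b c :: 3
    unfolding that(2) U2 bij_betw_def inj_on_def using that(1) ne(4) by auto
  have "UNIV - {1} = {2, 3::3}" "UNIV - {2} = {3, 1::3}" "UNIV - {3} = {1, 2::3}"
    unfolding U3 using ne ne[symmetric] by blast+
  then have "bij_betw (\<lambda>i::2. if i = 1 then 2 else 3::3) UNIV (UNIV - {1})"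
       "bij_betw (\<lambda>i::2. if i = 1 then 3 else 1::3) UNIV (UNIV - {2})"
       "bij_betw (\<lambda>i::2. if i = 1 then 1 else 2::3) UNIV (UNIV - {3})"
    using ne by (metis bij)+
  from this[THEN row_minor_square, of "D \<theta>"] show ?thesis
    by (simp add: surface_factor_def D_def d_def sum_3 det_2)
qed

definition immersed_boundary :: "(real^'n) set \<Rightarrow> (real^'m) set \<Rightarrow> (real^'m \<Rightarrow> real^'n) \<Rightarrow> bool" where
  "immersed_boundary \<Omega> \<Theta> X \<longleftrightarrow>
     (let \<Gamma> = X ` \<Theta> in
        \<Gamma> \<subseteq> \<Omega> \<and>
        (CARD('n) = 2 \<longrightarrow> simple_closed_curve \<Gamma>) \<and>
        (CARD('n) = 3 \<longrightarrow> closed_surface \<Gamma>) \<and>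
        (\<exists>\<Omega>\<^sub>0 \<Omega>\<^sub>1. \<Omega>\<^sub>0 \<noteq> \<Omega>\<^sub>1 \<and> components (\<Omega> - \<Gamma>) = {\<Omega>\<^sub>0, \<Omega>\<^sub>1}) \<and>
        C1_boundary \<Gamma> \<and> C1_on X \<Theta> \<and>
        setdist \<Gamma> (frontier \<Omega>) > 0 \<and>
        (\<forall>\<theta>\<in>\<Theta>. surface_factor X \<theta> \<noteq> 0))"


section \<open>Forces\<close>

definition force ::
  "(real^'n) set \<Rightarrow> (real^'m) set \<Rightarrow> (real^'m \<Rightarrow> real^'n) \<Rightarrow> (real^'m \<Rightarrow> real^'n) \<Rightarrow>
   (real^'n \<Rightarrow> real^'n) \<Rightarrow> real" where
  "force \<Omega> \<Theta> X F \<phi> = (LINT \<theta>|lebesgue_on \<Theta>. F \<theta> \<bullet> cont_rep \<Omega> \<phi> (X \<theta>))"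

definition reg_force ::
  "(real^'m) set \<Rightarrow> (real^'m \<Rightarrow> real^'n) \<Rightarrow> (real^'m \<Rightarrow> real^'n) \<Rightarrow> (real^'n \<Rightarrow> real) \<Rightarrow>
   real^'n \<Rightarrow> real^'n" where
  "reg_force \<Theta> X F \<delta> x = (LINT \<theta>|lebesgue_on \<Theta>. \<delta> (x - X \<theta>) *\<^sub>R F \<theta>)"

definition functional_of ::
  "(real^'n) set \<Rightarrow> (real^'n \<Rightarrow> real^'n) \<Rightarrow> (real^'n \<Rightarrow> real^'n) \<Rightarrow> real" where
  "functional_of \<Omega> g \<phi> = (LINT x|lebesgue_on \<Omega>. g x \<bullet> \<phi> x)"

end

theory Submission
  imports Defs
begin

text \<open>
  Let \<open>w\<close> be the continuous representative of a test field \<open>\<phi>\<close>, extended by zero outside \<open>\<Omega>\<close>. Fubini's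
  theorem turns \<open>\<langle>f - f\<^sup>\<epsilon>, \<phi>\<rangle>\<close> into \<open>\<integral>\<^sub>\<Theta> F(\<theta>) \<bullet> E(X(\<theta>)) d\<theta>\<close>, where
  \<open>E(x) = w(x) - \<integral> \<delta>(y) w(x + y) dy = (1 - \<integral> \<delta>) w(x) - \<integral> \<delta>(y) (w(x + y) - w(x)) dy\<close>
  (\<open>force_difference_representation\<close>). The estimate therefore reduces to a bound on \<open>E\<close> that is uniform in
  the point \<open>x\<close>; the integral of \<open>norm F\<close> is controlled by the \<open>L\<^sup>p\<close> norm since \<open>\<Theta>\<close> has finite measure.

  The pointwise bound comes from writing the increment of \<open>w\<close> along the segment from \<open>x\<close> to \<open>x + y\<close> as an
  integral of the gradient \<open>G\<close>, and applying Hoelder's inequality in \<open>y\<close> for each fixed \<open>t\<close>: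
  \<open>\<integral> norm (\<delta>(y) y) norm (G(x + t y)) dy \<le> \<parallel>\<rho> \<delta>\<parallel>\<^sub>p t\<^bsup>-n/p'\<^esup> \<parallel>G\<parallel>\<^sub>p\<^sub>'\<close>, because the substitution \<open>z = x + t y\<close>
  multiplies the integral of the \<open>p'\<close>-th power by \<open>t\<^bsup>-n\<^esup>\<close>. The exponent satisfies \<open>n/p' = n (p - 1)/p < 1\<close>
  exactly when \<open>p < n/(n - 1)\<close>, so the bound is integrable over \<open>t \<in> [0, 1]\<close>
  (\<open>weighted_increment_bound\<close>). The position \<open>x\<close> disappears in the substitution, hence the constant does not
  depend on the parametrization \<open>X\<close>. The bound on \<open>norm (w x)\<close> is the same inequality once more: for a weight
  supported so far from the origin that \<open>x + y \<notin> \<Omega>\<close>, the increment is \<open>-w(x)\<close> itself (\<open>sup_norm_bound\<close>).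

  The increment formula has to be justified for weak derivatives and across the boundary of \<open>\<Omega>\<close>, where the
  weak gradient is not defined. This is \<open>zero_extension_increment\<close>. Mollify \<open>w\<close>; at points far from the
  complement of \<open>\<Omega>\<close> the translated mollifier is an admissible test function, so the gradient of the mollified
  function is the mollified \<open>G\<close>. At the remaining points \<open>w\<close> is small by uniform continuity and by its vanishing
  outside \<open>\<Omega>\<close>, and composing with a \<open>C\<^sup>1\<close> soft threshold removes the gradient there at the price of a uniformly
  small error. The mollification of \<open>G\<close> is only an average over translates, harmless for a translation invariant
  bound.
\<close>

section \<open>Smooth mollifiers\<close>

text \<open>The bump \<open>exp (- 1 / (1 - t\<^sup>2))\<close> together with all expressions that arise from it by repeated
  differentiation: the family is closed under derivatives, which gives smoothness by induction.\<close>
definition bump_family :: "real poly \<Rightarrow> nat \<Rightarrow> real \<Rightarrow> real" where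
  "bump_family P k t =
     (if \<bar>t\<bar> < 1 then poly P t / (1 - t\<^sup>2) ^ k * exp (- (1 / (1 - t\<^sup>2))) else 0)"

text \<open>One term of the power series of \<open>exp (1 / s)\<close> beats any negative power of \<open>s\<close>. The two spare powers are
  what makes the members of the bump family differentiable at \<open>1\<close> and \<open>-1\<close>.\<close>
lemma exp_inverse_power_bound:
  fixes s :: real
  assumes "s > 0"
  shows "exp (- (1 / s)) / s ^ k \<le> fact (k + 2) * s\<^sup>2"
proof -
  have "(1 / s) ^ (k + 2) / fact (k + 2) \<le> exp (1 / s)"
  proof -
    have "(\<Sum>n\<in>{k + 2}. (1 / s) ^ n /\<^sub>R fact n) \<le> (\<Sum>n. (1 / s) ^ n /\<^sub>R fact n)"
      by (intro sum_le_suminf summable_exp_generic) (use assms in auto)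
    then show ?thesis
      by (simp add: exp_def divide_inverse_commute)
  qed
  moreover have "(1 / s) ^ (k + 2) / fact (k + 2) = 1 / (fact (k + 2) * s ^ (k + 2))"
    by (simp add: power_divide del: fact_Suc)
  moreover have "fact (k + 2) * s ^ (k + 2) > 0"
    using assms by simp
  ultimately have "1 \<le> exp (1 / s) * (fact (k + 2) * s ^ (k + 2))"
    by (metis pos_divide_le_eq)
  then have "exp (- (1 / s)) \<le> fact (k + 2) * s ^ (k + 2)"
    by (simp add: exp_minus pos_divide_le_eq inverse_eq_divide mult.commute del: fact_Suc power_Suc)
  also have "\<dots> = fact (k + 2) * s\<^sup>2 * s ^ k"
    by (metis mult.assoc mult.commute power_add)
  finally show ?thesis
    using assms by (simp add: pos_divide_le_eq del: fact_Suc power_Suc)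
qed

lemma bump_family_quadratic_bound:
  "\<exists>C\<ge>0. \<forall>t. \<bar>bump_family P k t\<bar> \<le> C * (1 - t\<^sup>2)\<^sup>2"
proof -
  have "compact (poly P ` {-1..1})"
    by (intro compact_continuous_image continuous_intros) auto
  then obtain M where M: "\<And>t. t \<in> {-1..1} \<Longrightarrow> \<bar>poly P t\<bar> \<le> M" "M > 0"
    by (metis bounded_pos compact_imp_bounded image_eqI real_norm_def)
  have "\<bar>bump_family P k t\<bar> \<le> M * fact (k + 2) * (1 - t\<^sup>2)\<^sup>2" for t
  proof (cases "\<bar>t\<bar> < 1")
    case True
    then have s: "1 - t\<^sup>2 > 0"
      by (simp add: abs_square_less_1)
    have "\<bar>bump_family P k t\<bar> = \<bar>poly P t\<bar> * (exp (- (1 / (1 - t\<^sup>2))) / (1 - t\<^sup>2) ^ k)"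
      using True s by (simp add: bump_family_def abs_mult)
    also have "\<dots> \<le> M * (fact (k + 2) * (1 - t\<^sup>2)\<^sup>2)"
      using M(1)[of t] M(2) True s by (intro mult_mono exp_inverse_power_bound) (auto simp: abs_less_iff)
    finally show ?thesis by simp
  next
    case False
    then show ?thesis using M by (simp add: bump_family_def)
  qed
  then show ?thesis using M(2) by (intro exI[of _ "M * fact (k + 2)"]) auto
qed

text \<open>The numerator is the quotient rule with everything brought to the denominator \<open>(1 - t\<^sup>2)\<^bsup>k+2\<^esup>\<close>; at \<open>1\<close> and
  \<open>-1\<close> the quadratic bound forces the derivative to be zero.\<close>
lemma bump_family_deriv:
  "(bump_family P k has_real_derivative
     bump_family (pderiv P * [:1, 0, -1:]\<^sup>2 + of_nat (2 * k) * [:0, 1:] * P * [:1, 0, -1:]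
       - [:0, 2:] * P) (k + 2) t) (at t)"
  (is "(_ has_real_derivative bump_family ?Q _ t) _")
proof (cases "\<bar>t\<bar> < 1")
  case True
  then have s: "1 - t\<^sup>2 > 0"
    by (simp add: abs_square_less_1)
  have ev: "eventually (\<lambda>x. x \<in> {-1<..<1}) (nhds t)"
    using True by (intro eventually_nhds_in_open) auto
  have "((\<lambda>t. poly P t / (1 - t\<^sup>2) ^ k * exp (- (1 / (1 - t\<^sup>2)))) has_real_derivative
     poly ?Q t / (1 - t\<^sup>2) ^ (k + 2) * exp (- (1 / (1 - t\<^sup>2)))) (at t)"
  proof -
    define d where "d = 1 - t\<^sup>2"
    have d: "d > 0" using s by (simp add: d_def)
    have "((\<lambda>t. poly P t / (1 - t\<^sup>2) ^ k * exp (- (1 / (1 - t\<^sup>2)))) has_real_derivative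
       (poly (pderiv P) t * (1 - t\<^sup>2) ^ k - poly P t * (real k * (- (2 * t)) * (1 - t\<^sup>2) ^ (k - 1)))
          / ((1 - t\<^sup>2) ^ k)\<^sup>2 * exp (- (1 / (1 - t\<^sup>2)))
       + poly P t / (1 - t\<^sup>2) ^ k * (exp (- (1 / (1 - t\<^sup>2))) * (- (2 * t) / (1 - t\<^sup>2)\<^sup>2))) (at t)"
      apply (rule derivative_eq_intros poly_DERIV refl | use s in force)+
      using s by (simp add: power2_eq_square mult_ac)
    also have "(poly (pderiv P) t * (1 - t\<^sup>2) ^ k - poly P t * (real k * (- (2 * t)) * (1 - t\<^sup>2) ^ (k - 1)))
          / ((1 - t\<^sup>2) ^ k)\<^sup>2 * exp (- (1 / (1 - t\<^sup>2)))
       + poly P t / (1 - t\<^sup>2) ^ k * (exp (- (1 / (1 - t\<^sup>2))) * (- (2 * t) / (1 - t\<^sup>2)\<^sup>2))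
       = (poly (pderiv P) t * d\<^sup>2 + 2 * real k * t * poly P t * d - 2 * t * poly P t) / d ^ (k + 2)
         * exp (- (1 / d))"
      unfolding d_def[symmetric]
    proof (cases k)
      case (Suc j)
      define D where "D = d ^ j"
      have "D > 0" "d ^ k = d * D" "d ^ (k - 1) = D" "d ^ (k + 2) = d * D * d\<^sup>2"
        using d by (simp_all add: D_def Suc power2_eq_square)
      then show "(poly (pderiv P) t * d ^ k - poly P t * (real k * (- (2 * t)) * d ^ (k - 1)))
          / (d ^ k)\<^sup>2 * exp (- (1 / d))
         + poly P t / d ^ k * (exp (- (1 / d)) * (- (2 * t) / d\<^sup>2))
         = (poly (pderiv P) t * d\<^sup>2 + 2 * real k * t * poly P t * d - 2 * t * poly P t) / d ^ (k + 2)
         * exp (- (1 / d))"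
        using d by (simp add: divide_simps power2_eq_square) (simp add: algebra_simps)
    qed (use d in \<open>simp add: divide_simps power2_eq_square; simp add: algebra_simps\<close>)
    also have "poly (pderiv P) t * d\<^sup>2 + 2 * real k * t * poly P t * d - 2 * t * poly P t = poly ?Q t"
      by (simp add: d_def power2_eq_square algebra_simps)
    finally show ?thesis unfolding d_def .
  qed
  then show ?thesis
    by (rule DERIV_cong_ev[THEN iffD2, rotated -1])
      (use True in \<open>auto intro: eventually_mono[OF ev] simp: bump_family_def abs_less_iff\<close>)
next
  case False
  obtain C where C: "C \<ge> 0" "\<And>t. \<bar>bump_family P k t\<bar> \<le> C * (1 - t\<^sup>2)\<^sup>2"
    using bump_family_quadratic_bound by blast
  have zero: "bump_family P k t = 0" "bump_family ?Q (k + 2) t = 0"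
    using False by (simp_all add: bump_family_def)
  show ?thesis
  proof (cases "\<bar>t\<bar> = 1")
    case True
    then have t2: "t\<^sup>2 = 1"
      by (metis one_power2 power2_abs)
    have "((\<lambda>h. bump_family P k (t + h) / h) \<longlongrightarrow> 0) (at 0)"
    proof (rule Lim_null_comparison)
      show "\<forall>\<^sub>F h in at 0. norm (bump_family P k (t + h) / h) \<le> C * \<bar>h\<bar> * (2 * t + h)\<^sup>2"
      proof (rule eventually_at_filter[THEN iffD2], rule always_eventually, clarify)
        fix h :: real assume "h \<noteq> 0"
        have "(1 - (t + h)\<^sup>2)\<^sup>2 = h\<^sup>2 * (2 * t + h)\<^sup>2"
          using t2 by (simp add: power2_sum) (simp add: power2_eq_square algebra_simps)
        then have "\<bar>bump_family P k (t + h)\<bar> \<le> (C * \<bar>h\<bar> * (2 * t + h)\<^sup>2) * \<bar>h\<bar>"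
          using C(2)[of "t + h"] by (simp add: power2_eq_square mult_ac abs_mult_self)
        with \<open>h \<noteq> 0\<close> show "norm (bump_family P k (t + h) / h) \<le> C * \<bar>h\<bar> * (2 * t + h)\<^sup>2"
          by (simp add: divide_le_eq)
      qed
      show "((\<lambda>h. C * \<bar>h\<bar> * (2 * t + h)\<^sup>2) \<longlongrightarrow> 0) (at 0)"
        by (auto intro!: tendsto_eq_intros)
    qed
    then show ?thesis
      unfolding DERIV_def zero by simp
  next
    case nt: False
    have ev: "eventually (\<lambda>x. x \<in> - {-1..1}) (nhds t)"
      using False nt by (intro eventually_nhds_in_open) auto
    have "((\<lambda>_. 0) has_real_derivative 0) (at t)" by simp
    then show ?thesis unfolding zero
      by (rule DERIV_cong_ev[THEN iffD2, rotated -1])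
        (auto intro!: eventually_mono[OF ev] simp: bump_family_def abs_less_iff)
  qed
qed

text \<open>A partial derivative of a product of functions of separate coordinates replaces one factor by its
  derivative, so products of members of the bump family are again closed under differentiation.\<close>
lemma Ck_fun_bump_product:
  assumes "\<And>i. \<exists>P k. c i = bump_family P k"
  shows "Ck_fun m (\<lambda>x::real^'n. \<Prod>i\<in>UNIV. c i (x $ i))"
  using assms
proof (induction m arbitrary: c)
  case 0
  have "continuous_on UNIV (c i)" for i
    proof -
    obtain P k where "c i = bump_family P k" using 0[of i] by auto
    then show ?thesis
      by (auto intro!: continuous_at_imp_continuous_on DERIV_isCont[OF bump_family_deriv])
  qed
  then have "continuous_on UNIV (\<lambda>x::real^'n. c i (x $ i))" for i
    by (rule continuous_on_compose2) (intro continuous_intros, simp)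
  then show ?case
    unfolding Ck_fun.simps by (intro continuous_on_prod)
next
  case (Suc m)
  have "\<exists>c'. \<forall>i. (\<exists>P k. c' i = bump_family P k) \<and>
      (\<forall>t. (c i has_real_derivative c' i t) (at t))"
  proof (rule choice, rule allI)
    fix i
    obtain P k where c: "c i = bump_family P k" using Suc.prems[of i] by auto
    show "\<exists>c'. (\<exists>P k. c' = bump_family P k) \<and> (\<forall>t. (c i has_real_derivative c' t) (at t))"
      unfolding c
      by (rule exI, rule conjI[OF _ allI[OF bump_family_deriv]], rule exI, rule exI, rule refl)
  qed
  then obtain c' where c': "\<And>i. (\<exists>P k. c' i = bump_family P k)"
      "\<And>i t. (c i has_real_derivative c' i t) (at t)"
    by blast
  have der: "((\<lambda>x::real^'n. \<Prod>i\<in>UNIV. c i (x $ i)) has_derivative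
      (\<lambda>y. \<Sum>i\<in>UNIV. (c' i (x $ i) * y $ i) * (\<Prod>j\<in>UNIV - {i}. c j (x $ j)))) (at x)" for x
  proof (rule has_derivative_prod)
    fix i
    have "(c i has_derivative (\<lambda>h. c' i (x $ i) * h)) (at (x $ i))"
      using c'(2) has_field_derivative_def by blast
    then show "((\<lambda>x. c i (x $ i)) has_derivative (\<lambda>y. c' i (x $ i) * y $ i)) (at x)"
      by (rule has_derivative_compose
          [OF bounded_linear_imp_has_derivative[OF bounded_linear_vec_nth]])
  qed
  have "partial_deriv i (\<lambda>x::real^'n. \<Prod>i\<in>UNIV. c i (x $ i)) =
      (\<lambda>x. \<Prod>j\<in>UNIV. (c(i := c' i)) j (x $ j))" for i
  proof
    fix x :: "real^'n"
    have "partial_deriv i (\<lambda>x::real^'n. \<Prod>i\<in>UNIV. c i (x $ i)) x =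
        (\<Sum>j\<in>UNIV. (c' j (x $ j) * axis i 1 $ j) * (\<Prod>l\<in>UNIV - {j}. c l (x $ l)))"
      unfolding partial_deriv_def frechet_derivative_at[OF der, symmetric] ..
    also have "\<dots> = c' i (x $ i) * (\<Prod>l\<in>UNIV - {i}. c l (x $ l))"
      by (subst sum.remove[of _ i]) (auto simp: axis_def)
    also have "\<dots> = (\<Prod>j\<in>UNIV. (c(i := c' i)) j (x $ j))"
      by (subst (2) prod.remove[of _ i]) auto
    finally show "partial_deriv i (\<lambda>x::real^'n. \<Prod>i\<in>UNIV. c i (x $ i)) x = \<dots>" .
  qed
  moreover have "Ck_fun m (\<lambda>x::real^'n. \<Prod>j\<in>UNIV. (c(i := c' i)) j (x $ j))" for i
  proof (rule Suc.IH)
    show "\<exists>P k. (c(i := c' i)) j = bump_family P k" for j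
      by (cases "j = i") (simp_all add: Suc.prems c'(1))
  qed
  ultimately show ?case
    using der by (auto simp: differentiable_def)
qed

lemma partial_deriv_affine:
  fixes f :: "real^'n \<Rightarrow> real"
  assumes "\<And>x. f differentiable (at x)"
  shows "((\<lambda>z. a * f (p + s *\<^sub>R z)) has_derivative
      (\<lambda>y. a * frechet_derivative f (at (p + s *\<^sub>R z)) (s *\<^sub>R y))) (at z)"
    and "partial_deriv i (\<lambda>z. a * f (p + s *\<^sub>R z)) = (\<lambda>z. (a * s) * partial_deriv i f (p + s *\<^sub>R z))"
proof -
  have d: "(f has_derivative frechet_derivative f (at x)) (at x)" for x
    using assms frechet_derivative_works by blast
  show *: "((\<lambda>z. a * f (p + s *\<^sub>R z)) has_derivative
      (\<lambda>y. a * frechet_derivative f (at (p + s *\<^sub>R z)) (s *\<^sub>R y))) (at z)" for z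
    by (rule has_derivative_mult_right, rule has_derivative_compose[OF _ d])
      (auto intro!: derivative_eq_intros)
  have "linear (frechet_derivative f (at x))" for x
    using assms linear_frechet_derivative by blast
  then show "partial_deriv i (\<lambda>z. a * f (p + s *\<^sub>R z)) = (\<lambda>z. (a * s) * partial_deriv i f (p + s *\<^sub>R z))"
    unfolding partial_deriv_def frechet_derivative_at[OF *, symmetric]
    by (auto simp: linear_cmul)
qed

lemma Ck_fun_affine:
  fixes f :: "real^'n \<Rightarrow> real"
  shows "Ck_fun k f \<Longrightarrow> Ck_fun k (\<lambda>z. a * f (p + s *\<^sub>R z))"
proof (induction k arbitrary: f a)
  case 0
  then show ?case
    by (auto intro!: continuous_intros continuous_on_compose2[of UNIV f])
next
  case (Suc k)
  then have d: "\<And>x. f differentiable (at x)" by simp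
  have "(\<lambda>z. a * f (p + s *\<^sub>R z)) differentiable (at z)" for z
    using partial_deriv_affine(1)[OF d] unfolding differentiable_def by blast
  then show ?case
    using Suc partial_deriv_affine(2)[OF d, where a = a and p = p and s = s] by simp
qed

lemma mollifier_exists:
  fixes r :: real
  assumes "r > 0"
  obtains \<psi> :: "real^'n \<Rightarrow> real" where "\<And>k. Ck_fun k \<psi>" "\<And>z. \<psi> z \<ge> 0"
    "\<And>z. \<psi> z \<noteq> 0 \<Longrightarrow> \<forall>i. \<bar>z $ i\<bar> < r" "(\<integral>\<^sup>+z. ennreal (\<psi> z) \<partial>lborel) = 1"
proof -
  define B where "B = (\<lambda>x::real^'n. \<Prod>i\<in>UNIV. bump_family 1 0 (x $ i))"
  have CB: "Ck_fun k B" for k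
    unfolding B_def using Ck_fun_bump_product[of "\<lambda>_. bump_family 1 0" k] by blast
  define B' where "B' = (\<lambda>z. 1 * B (0 + (1 / r) *\<^sub>R z))"
  have CB': "Ck_fun k B'" for k
    unfolding B'_def by (rule Ck_fun_affine[OF CB])
  have nn: "B' z \<ge> 0" for z
    by (auto simp: B'_def B_def bump_family_def intro!: prod_nonneg)
  have supp: "\<forall>i. \<bar>z $ i\<bar> < r" if "B' z \<noteq> 0" for z
  proof
    fix i
    have "bump_family 1 0 (z $ i / r) \<noteq> 0"
      using that by (auto simp: B'_def B_def)
    then show "\<bar>z $ i\<bar> < r"
      using assms by (auto simp: bump_family_def split: if_splits)
  qed
  have cont: "continuous_on UNIV B'" using CB'[of 0] by simp
  then have [measurable]: "B' \<in> borel_measurable borel" by (rule borel_measurable_continuous_onI)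
  have sub: "{z. B' z \<noteq> 0} \<subseteq> cbox (\<chi> i. -r) (\<chi> i. r)"
    proof
    fix z assume "z \<in> {z. B' z \<noteq> 0}"
    then have "\<bar>z $ i\<bar> < r" for i using supp by blast
    then show "z \<in> cbox (\<chi> i. -r) (\<chi> i. r)"
      unfolding mem_box_cart by (auto simp: abs_less_iff) (smt (verit))+
  qed
  have "integrable lborel (\<lambda>z. indicator (cbox (\<chi> i. -r) (\<chi> i. r)) z *\<^sub>R B' z)"
    by (rule borel_integrable_compact) (auto intro: continuous_on_subset[OF cont])
  then have int: "integrable lborel B'"
    by (rule Bochner_Integration.integrable_cong[THEN iffD1, rotated -1])
      (use sub in \<open>auto simp: indicator_def\<close>)
  define N where "N = (LINT z|lborel. B' z)"
  have "N \<noteq> 0"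
  proof
    assume "N = 0"
    then have "AE z in lborel. B' z = 0"
      using int nn unfolding N_def by (subst (asm) integral_nonneg_eq_0_iff_AE) auto
    then have "AE z in lborel. z \<notin> {z. B' z > 0}" by (auto elim!: eventually_mono)
    moreover have op: "open {z. B' z > 0}"
      using cont by (intro open_Collect_less continuous_intros)
    ultimately have "{z. B' z > 0} \<in> null_sets lborel"
      by (subst AE_iff_null_sets) auto
    then have "{z. B' z > 0} = {}"
      using op open_not_negligible negligible_iff_null_sets null_sets_completionI by blast
    moreover have "B' 0 > 0" by (simp add: B'_def B_def bump_family_def)
    ultimately show False by blast
  qed
  moreover have "N \<ge> 0" unfolding N_def using nn by simp
  ultimately have N: "N > 0" by simp
  show ?thesis
  proof
    show "Ck_fun k (\<lambda>z. (1 / N) * B' (0 + 1 *\<^sub>R z))" for k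
      by (rule Ck_fun_affine[OF CB'])
    show "(1 / N) * B' (0 + 1 *\<^sub>R z) \<ge> 0" for z using nn N by simp
    show "\<forall>i. \<bar>z $ i\<bar> < r" if "(1 / N) * B' (0 + 1 *\<^sub>R z) \<noteq> 0" for z
      using supp that by auto
    show "(\<integral>\<^sup>+z. ennreal ((1 / N) * B' (0 + 1 *\<^sub>R z)) \<partial>lborel) = 1"
      using int nn N by (subst nn_integral_eq_integral) (auto simp: N_def[symmetric])
  qed
qed

section \<open>Soft thresholding\<close>

text \<open>A \<open>C\<^sup>1\<close> function that vanishes on \<open>[-\<kappa>, \<kappa>]\<close>, has slope in \<open>[0, 1]\<close> and stays within \<open>2 \<kappa>\<close> of the identity.
  For \<open>s > \<kappa>\<close> it is \<open>s - 2 \<kappa> + \<kappa>\<^sup>2 / s\<close>.\<close>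
definition soft_threshold :: "real \<Rightarrow> real \<Rightarrow> real" where
  "soft_threshold \<kappa> s = (max (\<bar>s\<bar> - \<kappa>) 0)\<^sup>2 / s"

text \<open>The maximum in the denominator makes the formula vanish for \<open>\<bar>s\<bar> \<le> \<kappa>\<close> and makes continuity evident.\<close>
definition soft_threshold_deriv :: "real \<Rightarrow> real \<Rightarrow> real" where
  "soft_threshold_deriv \<kappa> s = 1 - (\<kappa> / max \<bar>s\<bar> \<kappa>)\<^sup>2"

lemma max_square_deriv: "((\<lambda>x::real. (max x 0)\<^sup>2) has_real_derivative 2 * max x 0) (at x)"
proof -
  consider "x > 0" | "x < 0" | "x = 0" by linarith
  then show ?thesis
  proof cases
    case 1
    then have ev: "eventually (\<lambda>x. x \<in> {0<..}) (nhds x)"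
      by (intro eventually_nhds_in_open) auto
    have "((\<lambda>x. x\<^sup>2) has_real_derivative 2 * x) (at x)"
      by (auto intro!: derivative_eq_intros)
    then have "((\<lambda>x. (max x 0)\<^sup>2) has_real_derivative 2 * x) (at x)"
      by (rule DERIV_cong_ev[THEN iffD2, rotated -1])
        (auto intro!: eventually_mono[OF ev] simp: max_def)
    then show ?thesis using 1 by (simp add: max_def)
  next
    case 2
    then have ev: "eventually (\<lambda>x. x \<in> {..<0}) (nhds x)"
      by (intro eventually_nhds_in_open) auto
    have "((\<lambda>x. 0) has_real_derivative 0) (at x)" by simp
    then have "((\<lambda>x. (max x 0)\<^sup>2) has_real_derivative 0) (at x)"
      by (rule DERIV_cong_ev[THEN iffD2, rotated -1])
        (auto intro!: eventually_mono[OF ev] simp: max_def)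
    then show ?thesis using 2 by (simp add: max_def)
  next
    case 3
    have "((\<lambda>h. (max h 0)\<^sup>2 / h) \<longlongrightarrow> 0) (at (0::real))"
    proof (rule Lim_null_comparison)
      show "\<forall>\<^sub>F h in at (0::real). norm ((max h 0)\<^sup>2 / h) \<le> \<bar>h\<bar>"
        by (intro always_eventually) (auto simp: max_def power2_eq_square)
      show "((\<lambda>h. \<bar>h\<bar>) \<longlongrightarrow> 0) (at (0::real))"
        by (auto intro!: tendsto_eq_intros)
    qed
    then show ?thesis using 3 unfolding DERIV_def by simp
  qed
qed

lemma soft_threshold_has_deriv:
  assumes "\<kappa> > 0"
  shows "(soft_threshold \<kappa> has_real_derivative soft_threshold_deriv \<kappa> s) (at s)"
proof (cases "\<bar>s\<bar> < \<kappa>")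
  case True
  then have ev: "eventually (\<lambda>x. x \<in> {-\<kappa><..<\<kappa>}) (nhds s)"
    by (intro eventually_nhds_in_open) auto
  have "((\<lambda>x. 0) has_real_derivative 0) (at s)" by simp
  then have "(soft_threshold \<kappa> has_real_derivative 0) (at s)"
    by (rule DERIV_cong_ev[THEN iffD2, rotated -1])
      (auto intro!: eventually_mono[OF ev] simp: soft_threshold_def max_def)
  then show ?thesis using True assms by (simp add: soft_threshold_deriv_def max_def)
next
  case False
  with assms have s: "s \<noteq> 0" by auto
  have eq: "soft_threshold \<kappa> = (\<lambda>s. ((max (s - \<kappa>) 0)\<^sup>2 + (max (- s - \<kappa>) 0)\<^sup>2) / s)"
    using assms by (auto simp: soft_threshold_def max_def fun_eq_iff)
  have "((\<lambda>s. s - \<kappa>) has_real_derivative 1) (at s)"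
      "((\<lambda>s. - s - \<kappa>) has_real_derivative -1) (at s)"
    by (auto intro!: derivative_eq_intros)
  from this[THEN DERIV_chain'[OF _ max_square_deriv]]
  have d1: "((\<lambda>s. (max (s - \<kappa>) 0)\<^sup>2) has_real_derivative 2 * max (s - \<kappa>) 0) (at s)"
    and d2: "((\<lambda>s. (max (- s - \<kappa>) 0)\<^sup>2) has_real_derivative - (2 * max (- s - \<kappa>) 0)) (at s)"
    by simp_all
  have "((\<lambda>s. ((max (s - \<kappa>) 0)\<^sup>2 + (max (- s - \<kappa>) 0)\<^sup>2) / s) has_real_derivative
     ((2 * max (s - \<kappa>) 0 + - (2 * max (- s - \<kappa>) 0)) * s
       - ((max (s - \<kappa>) 0)\<^sup>2 + (max (- s - \<kappa>) 0)\<^sup>2) * 1) / (s * s)) (at s)"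
    by (intro DERIV_divide DERIV_add d1 d2 s DERIV_ident)
  also have "((2 * max (s - \<kappa>) 0 + - (2 * max (- s - \<kappa>) 0)) * s
       - ((max (s - \<kappa>) 0)\<^sup>2 + (max (- s - \<kappa>) 0)\<^sup>2) * 1) / (s * s) = soft_threshold_deriv \<kappa> s"
  proof (cases "s > 0")
    case True
    then have "max (s - \<kappa>) 0 = s - \<kappa>" "max (- s - \<kappa>) 0 = 0" "max \<bar>s\<bar> \<kappa> = s"
      using False assms by auto
    then show ?thesis using True
      unfolding soft_threshold_deriv_def
      by (simp add: divide_simps power2_eq_square) (simp add: algebra_simps)
  next
    case neg: False
    then have "max (s - \<kappa>) 0 = 0" "max (- s - \<kappa>) 0 = - s - \<kappa>" "max \<bar>s\<bar> \<kappa> = - s"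
      using False assms by auto
    then show ?thesis using s
      unfolding soft_threshold_deriv_def
      by (simp add: divide_simps power2_eq_square) (simp add: algebra_simps)
  qed
  finally show ?thesis unfolding eq .
qed

lemma soft_threshold_deriv_bounds:
  assumes "\<kappa> > 0"
  shows "\<bar>soft_threshold_deriv \<kappa> s\<bar> \<le> 1"
    and "\<bar>s\<bar> \<le> \<kappa> \<Longrightarrow> soft_threshold_deriv \<kappa> s = 0"
    and "continuous_on UNIV (soft_threshold_deriv \<kappa>)"
proof -
  have "0 \<le> \<kappa> / max \<bar>s\<bar> \<kappa>" "\<kappa> / max \<bar>s\<bar> \<kappa> \<le> 1"
    using assms by (auto simp: divide_le_eq)
  then have "(\<kappa> / max \<bar>s\<bar> \<kappa>)\<^sup>2 \<le> 1" "(\<kappa> / max \<bar>s\<bar> \<kappa>)\<^sup>2 \<ge> 0"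
    by (auto simp: power_le_one)
  then show "\<bar>soft_threshold_deriv \<kappa> s\<bar> \<le> 1"
    unfolding soft_threshold_deriv_def by linarith
  show "\<bar>s\<bar> \<le> \<kappa> \<Longrightarrow> soft_threshold_deriv \<kappa> s = 0"
    using assms by (simp add: soft_threshold_deriv_def max_def)
  show "continuous_on UNIV (soft_threshold_deriv \<kappa>)"
    unfolding soft_threshold_deriv_def using assms
    by (intro continuous_intros) (auto simp: max_def)
qed

lemma soft_threshold_close:
  assumes "\<kappa> > 0"
  shows "\<bar>soft_threshold \<kappa> s - s\<bar> \<le> 2 * \<kappa>"
proof (cases "\<bar>s\<bar> \<le> \<kappa>")
  case True
  then show ?thesis using assms by (simp add: soft_threshold_def max_def)
next
  case False
  then have s: "s \<noteq> 0" "\<kappa> < \<bar>s\<bar>" using assms by auto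
  have "\<bar>s\<bar>\<^sup>2 = s\<^sup>2" by simp
  then have "soft_threshold \<kappa> s - s = \<kappa> * (\<kappa> - 2 * \<bar>s\<bar>) / s"
    using s by (simp add: soft_threshold_def max_def field_simps power2_eq_square)
  then have "\<bar>soft_threshold \<kappa> s - s\<bar> = \<kappa> * (2 * \<bar>s\<bar> - \<kappa>) / \<bar>s\<bar>"
    using s assms by (simp add: abs_mult)
  also have "\<dots> \<le> 2 * \<kappa>"
    using s assms by (simp add: divide_le_eq algebra_simps)
  finally show ?thesis .
qed

section \<open>Increments of the zero extension\<close>

lemma lborel_reflect: "distr lborel borel (\<lambda>z::'a::euclidean_space. p - z) = lborel"
  using lborel_affine[of "-1" p, symmetric]
  by (simp add: density_1 one_ennreal_def[symmetric])

lemma nn_integral_reflect: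
  fixes f :: "'a::euclidean_space \<Rightarrow> ennreal"
  assumes [measurable]: "f \<in> borel_measurable borel"
  shows "(\<integral>\<^sup>+z. f (p - z) \<partial>lborel) = (\<integral>\<^sup>+z. f z \<partial>lborel)"
proof -
  have "(\<integral>\<^sup>+z. f z \<partial>lborel) = (\<integral>\<^sup>+z. f z \<partial>distr lborel borel (\<lambda>z. p - z))"
    by (simp only: lborel_reflect)
  also have "\<dots> = (\<integral>\<^sup>+z. f (p - z) \<partial>lborel)"
    by (subst nn_integral_distr) auto
  finally show ?thesis ..
qed

lemma integral_cbox_eq_lborel:
  fixes f :: "real^'n \<Rightarrow> real"
  assumes f: "continuous_on UNIV f" and 0: "\<And>z. z \<notin> cbox a b \<Longrightarrow> f z = 0"
  shows "integrable lborel f" "integral (cbox a b) f = (LINT z|lborel. f z)"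
proof -
  have "integrable lborel (\<lambda>z. indicator (cbox a b) z *\<^sub>R f z)"
    by (rule borel_integrable_compact) (auto intro: continuous_on_subset[OF f])
  moreover have *: "(\<lambda>z. indicator (cbox a b) z *\<^sub>R f z) = f"
    using 0 by (auto simp: indicator_def fun_eq_iff)
  ultimately show i: "integrable lborel f" by simp
  show "integral (cbox a b) f = (LINT z|lborel. f z)"
    using set_borel_integral_eq_integral(2)[of "cbox a b" f] i
    unfolding set_integrable_def set_lebesgue_integral_def * by simp
qed

text \<open>All derivatives fall on the mollifier. Differentiating only along a line keeps the parameter in the Leibniz
  rule one-dimensional, and the fundamental theorem of calculus is applied along lines anyway.\<close>
lemma mollified_line_deriv:
  fixes u \<psi> :: "real^'n \<Rightarrow> real" and a b :: "real^'n"
  assumes u: "continuous_on UNIV u" and \<psi>: "\<And>k. Ck_fun k \<psi>"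
  defines "m \<equiv> \<lambda>p. integral (cbox a b) (\<lambda>z. u z * \<psi> (p - z))"
  defines "dm \<equiv> \<lambda>i p. integral (cbox a b) (\<lambda>z. u z * partial_deriv i \<psi> (p - z))"
  shows "((\<lambda>t. m (x + t *\<^sub>R y)) has_real_derivative (\<Sum>i\<in>UNIV. y $ i * dm i (x + t *\<^sub>R y))) (at t)"
    and "continuous_on UNIV (dm i)"
proof -
  have c0: "continuous_on UNIV \<psi>" using \<psi>[of 0] by simp
  have c1: "continuous_on UNIV (partial_deriv i \<psi>)" for i using \<psi>[of "Suc 0"] by simp
  have d: "(\<psi> has_derivative frechet_derivative \<psi> (at x)) (at x)" for x
    using \<psi>[of "Suc 0"] frechet_derivative_works by auto
  have fd: "frechet_derivative \<psi> (at q) y = (\<Sum>i\<in>UNIV. y $ i * partial_deriv i \<psi> q)" for q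
  proof -
    have lin: "linear (frechet_derivative \<psi> (at q))"
      using \<psi>[of "Suc 0"] linear_frechet_derivative by auto
    have "frechet_derivative \<psi> (at q) (\<Sum>i\<in>UNIV. y $ i *\<^sub>R axis i 1) =
       (\<Sum>i\<in>UNIV. y $ i * partial_deriv i \<psi> q)"
      by (simp add: linear_sum[OF lin] linear_cmul[OF lin] partial_deriv_def)
    then show ?thesis using basis_expansion[of y] by (simp add: scalar_mult_eq_scaleR)
  qed
  have line: "((\<lambda>t. u z * \<psi> (x + t *\<^sub>R y - z)) has_real_derivative
      u z * (\<Sum>i\<in>UNIV. y $ i * partial_deriv i \<psi> (x + t *\<^sub>R y - z))) (at t)" for t z
  proof -
    have "((\<lambda>t. x + t *\<^sub>R y - z) has_derivative (\<lambda>h. h *\<^sub>R y)) (at t)"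
      by (auto intro!: derivative_eq_intros)
    from has_derivative_compose[OF this d]
    have "((\<lambda>t. \<psi> (x + t *\<^sub>R y - z)) has_derivative
       (\<lambda>h. frechet_derivative \<psi> (at (x + t *\<^sub>R y - z)) (h *\<^sub>R y))) (at t)" .
    moreover have "frechet_derivative \<psi> (at q) (h *\<^sub>R y) =
        (\<Sum>i\<in>UNIV. y $ i * partial_deriv i \<psi> q) * h" for q h
    proof -
      have "linear (frechet_derivative \<psi> (at q))"
        using \<psi>[of "Suc 0"] linear_frechet_derivative by auto
      then show ?thesis by (simp add: linear_cmul fd)
    qed
    ultimately have "((\<lambda>t. \<psi> (x + t *\<^sub>R y - z)) has_real_derivative
        (\<Sum>i\<in>UNIV. y $ i * partial_deriv i \<psi> (x + t *\<^sub>R y - z))) (at t)"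
      by (simp add: has_field_derivative_def)
    then show ?thesis by (rule DERIV_cmult)
  qed
  have cont: "continuous_on UNIV (\<lambda>z. u z * partial_deriv i \<psi> (q - z))" for i q
    by (intro continuous_intros u continuous_on_compose2[OF c1]) auto
  have "((\<lambda>t. integral (cbox a b) (\<lambda>z. u z * \<psi> (x + t *\<^sub>R y - z))) has_real_derivative
      integral (cbox a b) (\<lambda>z. u z * (\<Sum>i\<in>UNIV. y $ i * partial_deriv i \<psi> (x + t *\<^sub>R y - z)))) (at t within UNIV)"
  proof (rule leibniz_rule_field_derivative)
    show "(\<lambda>z. u z * \<psi> (x + t *\<^sub>R y - z)) integrable_on cbox a b" for t
      by (intro integrable_continuous continuous_intros continuous_on_subset[OF u]
          continuous_on_compose2[OF c0]) auto
    show "continuous_on (UNIV \<times> cbox a b)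
       (\<lambda>(t, z). u z * (\<Sum>i\<in>UNIV. y $ i * partial_deriv i \<psi> (x + t *\<^sub>R y - z)))"
      unfolding split_beta
      by (intro continuous_intros continuous_on_compose2[OF u] continuous_on_compose2[OF c1]) auto
  qed (use line in auto)
  also have "integral (cbox a b) (\<lambda>z. u z * (\<Sum>i\<in>UNIV. y $ i * partial_deriv i \<psi> (x + t *\<^sub>R y - z)))
     = integral (cbox a b) (\<lambda>z. \<Sum>i\<in>UNIV. y $ i * (u z * partial_deriv i \<psi> (x + t *\<^sub>R y - z)))"
    by (simp add: sum_distrib_left mult_ac)
  also have "\<dots> = (\<Sum>i\<in>UNIV. y $ i * dm i (x + t *\<^sub>R y))"
    unfolding dm_def
    by (subst integral_sum)
       (auto intro!: integrable_continuous continuous_on_mult continuous_on_const continuous_on_subset[OF cont])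
  finally show "((\<lambda>t. m (x + t *\<^sub>R y)) has_real_derivative
      (\<Sum>i\<in>UNIV. y $ i * dm i (x + t *\<^sub>R y))) (at t)"
    unfolding m_def by simp
  show "continuous_on UNIV (dm i)"
    unfolding dm_def
    by (intro integral_continuous_on_param, unfold split_beta)
      (intro continuous_intros continuous_on_compose2[OF u] continuous_on_compose2[OF c1], auto)
qed

text \<open>When the box of radius \<open>r\<close> around \<open>p\<close> lies inside \<open>\<Omega>\<close>, the reflected mollifier \<open>\<psi> (p - z)\<close> is a test function
  of \<open>z\<close>, and the weak derivative moves the partial derivative from \<open>\<psi>\<close> to \<open>u\<close>. Stating the result with a Borel
  majorant \<open>H\<close> of the weak derivative makes it usable in iterated integrals later.\<close>
lemma mollified_partial_bound:
  fixes u \<psi> H :: "real^'n \<Rightarrow> real"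
  assumes \<Omega>: "open \<Omega>"
    and u: "continuous_on UNIV u" and u0: "\<And>x. x \<notin> \<Omega> \<Longrightarrow> u x = 0" and sub: "\<Omega> \<subseteq> cbox a b"
    and weak: "\<And>\<psi>. \<psi> \<in> test_functions \<Omega> \<Longrightarrow>
       (LINT x|lebesgue_on \<Omega>. u x * partial_deriv i \<psi> x) = - (LINT x|lebesgue_on \<Omega>. g x * \<psi> x)"
    and H: "AE x in lebesgue_on \<Omega>. \<bar>g x\<bar> \<le> H x"
    and H_meas [measurable]: "H \<in> borel_measurable borel" and H0: "\<And>x. H x \<ge> 0"
    and \<psi>: "\<And>k. Ck_fun k \<psi>" "\<And>z. \<psi> z \<ge> 0" "\<And>z. \<psi> z \<noteq> 0 \<Longrightarrow> \<forall>i. \<bar>z $ i\<bar> < r"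
    and p: "cbox (p - (\<chi> i. r)) (p + (\<chi> i. r)) \<subseteq> \<Omega>"
  shows "ennreal \<bar>integral (cbox a b) (\<lambda>z. u z * partial_deriv i \<psi> (p - z))\<bar>
     \<le> (\<integral>\<^sup>+z. ennreal (H (p - z)) * ennreal (\<psi> z) \<partial>lborel)"
proof -
  have c0: "continuous_on UNIV \<psi>" using \<psi>(1)[of 0] by simp
  have c1: "continuous_on UNIV (partial_deriv i \<psi>)" using \<psi>(1)[of "Suc 0"] by simp
  have [measurable]: "\<psi> \<in> borel_measurable borel"
    using c0 by (rule borel_measurable_continuous_onI)
  define \<psi>p where "\<psi>p = (\<lambda>z. 1 * \<psi> (p + (-1) *\<^sub>R z))"
  have supp: "{z. \<psi>p z \<noteq> 0} \<subseteq> cbox (p - (\<chi> i. r)) (p + (\<chi> i. r))"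
  proof
    fix z assume "z \<in> {z. \<psi>p z \<noteq> 0}"
    then have "\<bar>(p - z) $ j\<bar> < r" for j using \<psi>(3)[of "p - z"] by (auto simp: \<psi>p_def)
    then have "p $ j - r \<le> z $ j \<and> z $ j \<le> p $ j + r" for j
      using abs_less_iff[of "p $ j - z $ j" r] by (simp add: algebra_simps)
    then show "z \<in> cbox (p - (\<chi> i. r)) (p + (\<chi> i. r))"
      by (auto simp: mem_box_cart)
  qed
  then have "closure {z. \<psi>p z \<noteq> 0} \<subseteq> cbox (p - (\<chi> i. r)) (p + (\<chi> i. r))"
    by (rule closure_minimal) (rule closed_cbox)
  moreover from supp have "bounded {z. \<psi>p z \<noteq> 0}"
    using bounded_cbox bounded_subset by blast
  moreover have "Ck_fun k \<psi>p" for k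
    unfolding \<psi>p_def by (rule Ck_fun_affine[OF \<psi>(1)])
  ultimately have test: "\<psi>p \<in> test_functions \<Omega>"
    using p unfolding test_functions_def by auto
  have pd: "partial_deriv i \<psi>p z = - partial_deriv i \<psi> (p - z)" for z
    unfolding \<psi>p_def using partial_deriv_affine(2)[of \<psi> i 1 p "-1"] \<psi>(1)[of "Suc 0"] by simp
  have "integral (cbox a b) (\<lambda>z. u z * partial_deriv i \<psi> (p - z)) =
     (LINT z|lborel. u z * partial_deriv i \<psi> (p - z))"
  proof (rule integral_cbox_eq_lborel)
    show "continuous_on UNIV (\<lambda>z. u z * partial_deriv i \<psi> (p - z))"
      by (intro continuous_intros u continuous_on_compose2[OF c1]) auto
  qed (use u0 sub in auto)
  also have "\<dots> = (LINT z|lebesgue. u z * partial_deriv i \<psi> (p - z))"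
  proof (rule integral_completion[symmetric])
    have "continuous_on UNIV (\<lambda>z. u z * partial_deriv i \<psi> (p - z))"
      by (intro continuous_intros u continuous_on_compose2[OF c1]) auto
    then show "(\<lambda>z. u z * partial_deriv i \<psi> (p - z)) \<in> borel_measurable lborel"
      using borel_measurable_continuous_onI by simp
  qed
  also have "\<dots> = (LINT z|lebesgue. indicator \<Omega> z *\<^sub>R (u z * partial_deriv i \<psi> (p - z)))"
    by (rule Bochner_Integration.integral_cong) (use u0 in \<open>auto simp: indicator_def\<close>)
  also have "\<dots> = (LINT z|lebesgue_on \<Omega>. u z * partial_deriv i \<psi> (p - z))"
    using \<Omega> by (subst integral_restrict_space[where M = lebesgue]) auto
  also have "\<dots> = - (LINT z|lebesgue_on \<Omega>. u z * partial_deriv i \<psi>p z)"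
    by (simp add: pd)
  also have "\<dots> = (LINT z|lebesgue_on \<Omega>. g z * \<psi>p z)"
    using weak[OF test] by simp
  finally have eq: "integral (cbox a b) (\<lambda>z. u z * partial_deriv i \<psi> (p - z)) =
      (LINT z|lebesgue_on \<Omega>. g z * \<psi>p z)" .
  have "ennreal \<bar>LINT z|lebesgue_on \<Omega>. g z * \<psi>p z\<bar> \<le> (\<integral>\<^sup>+z. ennreal \<bar>g z * \<psi>p z\<bar> \<partial>lebesgue_on \<Omega>)"
  proof (cases "integrable (lebesgue_on \<Omega>) (\<lambda>z. g z * \<psi>p z)")
    case True
    then show ?thesis using integral_norm_bound_ennreal[OF True] by simp
  qed (simp add: not_integrable_integral_eq)
  also have "\<dots> \<le> (\<integral>\<^sup>+z. ennreal (H z * \<psi>p z) \<partial>lebesgue_on \<Omega>)"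
    by (rule nn_integral_mono_AE, rule eventually_mono[OF H])
       (use \<psi>(2) in \<open>auto intro!: ennreal_leI mult_right_mono simp: abs_mult \<psi>p_def\<close>)
  also have "\<dots> = (\<integral>\<^sup>+z. ennreal (H z * \<psi>p z) * indicator \<Omega> z \<partial>lebesgue)"
    using \<Omega> by (subst nn_integral_restrict_space) auto
  also have "\<dots> \<le> (\<integral>\<^sup>+z. ennreal (H z * \<psi>p z) \<partial>lebesgue)"
    by (rule nn_integral_mono) (auto simp: indicator_def)
  also have "\<dots> = (\<integral>\<^sup>+z. ennreal (H z * \<psi>p z) \<partial>lborel)"
    by (rule nn_integral_completion)
  also have "\<dots> = (\<integral>\<^sup>+z. ennreal (H (p - z) * \<psi>p (p - z)) \<partial>lborel)"
    by (subst nn_integral_reflect[where p = p, symmetric]) (auto simp: \<psi>p_def)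
  also have "\<dots> = (\<integral>\<^sup>+z. ennreal (H (p - z)) * ennreal (\<psi> z) \<partial>lborel)"
    using H0 \<psi>(2) by (simp add: \<psi>p_def ennreal_mult)
  finally show ?thesis unfolding eq .
qed

text \<open>An approximate fundamental theorem of calculus for the zero extension of a Sobolev function, with the gradient
  averaged over translates. Where the box around a point is not contained in \<open>\<Omega>\<close>, so that the mollifier is not a
  test function, the box contains a zero of \<open>u\<close>; hence \<open>u\<close> is small there and the soft threshold cuts the point off.\<close>
lemma zero_extension_increment:
  fixes u H :: "real^'n \<Rightarrow> real" and g :: "'n \<Rightarrow> real^'n \<Rightarrow> real"
  assumes \<Omega>: "open \<Omega>" "bounded \<Omega>"
    and u: "continuous_on UNIV u" and u0: "\<And>x. x \<notin> \<Omega> \<Longrightarrow> u x = 0"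
    and weak: "\<And>i \<psi>. \<psi> \<in> test_functions \<Omega> \<Longrightarrow>
       (LINT x|lebesgue_on \<Omega>. u x * partial_deriv i \<psi> x) = - (LINT x|lebesgue_on \<Omega>. g i x * \<psi> x)"
    and H: "\<And>i. AE x in lebesgue_on \<Omega>. \<bar>g i x\<bar> \<le> H x"
    and H_meas [measurable]: "H \<in> borel_measurable borel" and H0: "\<And>x. H x \<ge> 0"
    and \<eta>: "\<eta> > 0"
  obtains \<psi> where "continuous_on UNIV \<psi>" "\<And>z. \<psi> z \<ge> 0" "(\<integral>\<^sup>+z. ennreal (\<psi> z) \<partial>lborel) = 1"
    "\<And>x y. ennreal \<bar>u (x + y) - u x\<bar> \<le> ennreal \<eta> + of_nat CARD('n) * ennreal (norm y) *
       (\<integral>\<^sup>+t. (\<integral>\<^sup>+z. ennreal (H (x + t *\<^sub>R y - z)) * ennreal (\<psi> z) \<partial>lborel) * indicator {0..1} t \<partial>lborel)"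
proof -
  \<comment> \<open>Each endpoint contributes \<open>\<kappa>\<close> from mollifying and \<open>4 \<kappa>\<close> from thresholding at \<open>2 \<kappa>\<close>.\<close>
  define \<kappa> where "\<kappa> = \<eta> / 10"
  have \<kappa>: "\<kappa> > 0" using \<eta> by (simp add: \<kappa>_def)
  obtain R where R: "\<And>x. x \<in> \<Omega> \<Longrightarrow> norm x \<le> R"
    using \<Omega>(2) bounded_iff by blast
  have "\<exists>d>0. \<forall>p q. norm (p - q) < d \<longrightarrow> \<bar>u p - u q\<bar> < \<kappa>"
  proof -
    have "uniformly_continuous_on (cball 0 (R + 1)) u"
      by (intro compact_uniformly_continuous continuous_on_subset[OF u]) auto
    then obtain d where d: "d > 0" "\<And>p q. p \<in> cball 0 (R + 1) \<Longrightarrow> q \<in> cball 0 (R + 1) \<Longrightarrow>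
        dist p q < d \<Longrightarrow> dist (u p) (u q) < \<kappa>"
      unfolding uniformly_continuous_on_def using \<kappa> by (metis dist_commute)
    have "\<bar>u p - u q\<bar> < \<kappa>" if pq: "norm (p - q) < min d 1" for p q
    proof (cases "norm p \<le> R \<or> norm q \<le> R")
      case True
      then have "p \<in> cball 0 (R + 1)" "q \<in> cball 0 (R + 1)"
        using pq norm_triangle_ineq2[of p q] norm_triangle_ineq2[of q p]
        by (auto simp: norm_minus_commute)
      then show ?thesis using d(2)[of p q] pq by (simp add: dist_norm)
    next
      case False
      then have "u p = 0" "u q = 0" using R u0 by blast+
      then show ?thesis using \<kappa> by simp
    qed
    then show ?thesis using d(1) by (intro exI[of _ "min d 1"]) auto
  qed
  then obtain d where d: "d > 0" "\<And>p q. norm (p - q) < d \<Longrightarrow> \<bar>u p - u q\<bar> < \<kappa>" by blast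
  \<comment> \<open>Boxes of half-width \<open>r\<close> have to lie in balls of radius \<open>d\<close>.\<close>
  define r where "r = d / (2 * CARD('n))"
  have r: "r > 0" using d by (simp add: r_def)
  have near: "norm (z :: real^'n) < d" if "\<And>i. \<bar>z $ i\<bar> \<le> r" for z
  proof -
    have "norm z \<le> (\<Sum>i\<in>UNIV. \<bar>z $ i\<bar>)" by (rule norm_le_l1_cart)
    also have "\<dots> \<le> (\<Sum>i\<in>(UNIV::'n set). r)" by (rule sum_mono) (use that in auto)
    also have "\<dots> = d / 2" by (simp add: r_def)
    finally show ?thesis using d(1) by simp
  qed
  obtain \<psi> :: "real^'n \<Rightarrow> real" where \<psi>: "\<And>k. Ck_fun k \<psi>" "\<And>z. \<psi> z \<ge> 0"
      "\<And>z. \<psi> z \<noteq> 0 \<Longrightarrow> \<forall>i. \<bar>z $ i\<bar> < r" "(\<integral>\<^sup>+z. ennreal (\<psi> z) \<partial>lborel) = 1"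
    using mollifier_exists[OF r] by metis
  have c0: "continuous_on UNIV \<psi>" using \<psi>(1)[of 0] by simp
  then have [measurable]: "\<psi> \<in> borel_measurable borel" by (rule borel_measurable_continuous_onI)
  obtain a b where ab: "\<Omega> \<subseteq> cbox a b" using \<Omega>(2) bounded_subset_cbox_symmetric by metis
  define m where "m = (\<lambda>p. integral (cbox a b) (\<lambda>z. u z * \<psi> (p - z)))"
  define dm where "dm = (\<lambda>i p. integral (cbox a b) (\<lambda>z. u z * partial_deriv i \<psi> (p - z)))"
  define A where "A = (\<lambda>p. \<integral>\<^sup>+z. ennreal (H (p - z)) * ennreal (\<psi> z) \<partial>lborel)"
  have m_close: "\<bar>m p - u p\<bar> \<le> \<kappa>" for p
  proof -
    have nn: "(\<integral>\<^sup>+z. ennreal (\<psi> (p - z)) \<partial>lborel) = 1"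
      using nn_integral_reflect[of "\<lambda>z. ennreal (\<psi> z)" p] \<psi>(4) by simp
    have int: "integrable lborel (\<lambda>z. \<psi> (p - z))"
      by (rule integrableI_nonneg) (use nn \<psi>(2) in auto)
    have I1: "(LINT z|lborel. \<psi> (p - z)) = 1"
      using nn_integral_eq_integral[OF int] nn \<psi>(2) by simp
    have *: "continuous_on UNIV (\<lambda>z. u z * \<psi> (p - z))"
      by (intro continuous_intros u continuous_on_compose2[OF c0]) auto
    have **: "z \<notin> cbox a b \<Longrightarrow> u z * \<psi> (p - z) = 0" for z
      using ab u0 by auto
    have m: "m p = (LINT z|lborel. u z * \<psi> (p - z))" "integrable lborel (\<lambda>z. u z * \<psi> (p - z))"
      unfolding m_def using integral_cbox_eq_lborel[OF * **] by auto
    have "m p - u p = (LINT z|lborel. u z * \<psi> (p - z)) - (LINT z|lborel. u p * \<psi> (p - z))"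
      using I1 m by simp
    also have "\<dots> = (LINT z|lborel. u z * \<psi> (p - z) - u p * \<psi> (p - z))"
      using int m by (subst Bochner_Integration.integral_diff) auto
    finally have "\<bar>m p - u p\<bar> = \<bar>LINT z|lborel. u z * \<psi> (p - z) - u p * \<psi> (p - z)\<bar>" by simp
    also have "\<dots> \<le> (LINT z|lborel. \<kappa> * \<psi> (p - z))"
    proof (rule integral_abs_bound_integral)
      show "\<bar>u z * \<psi> (p - z) - u p * \<psi> (p - z)\<bar> \<le> \<kappa> * \<psi> (p - z)" for z
      proof (cases "\<psi> (p - z) = 0")
        case False
        then have "norm (p - z) < d" using near \<psi>(3)[of "p - z"] less_imp_le by blast
        then have "\<bar>u z - u p\<bar> \<le> \<kappa>" using d(2)[of z p] by (simp add: norm_minus_commute)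
        then have "\<bar>u z - u p\<bar> * \<psi> (p - z) \<le> \<kappa> * \<psi> (p - z)"
          by (rule mult_right_mono) (rule \<psi>(2))
        then show ?thesis using \<psi>(2)[of "p - z"]
          by (simp add: left_diff_distrib[symmetric] abs_mult)
      qed simp
    qed (use int m in auto)
    finally show ?thesis using I1 by simp
  qed
  define T where "T = soft_threshold (2 * \<kappa>)"
  define T' where "T' = soft_threshold_deriv (2 * \<kappa>)"
  have \<kappa>2: "2 * \<kappa> > 0" using \<kappa> by simp
  note T = soft_threshold_has_deriv[OF \<kappa>2, folded T_def T'_def]
    soft_threshold_close[OF \<kappa>2, folded T_def T'_def]
  note T' = soft_threshold_deriv_bounds[OF \<kappa>2, folded T_def T'_def]
  \<comment> \<open>Either the box around \<open>p\<close> is inside \<open>\<Omega>\<close>, or it meets the zero set of \<open>u\<close> and the threshold is flat at \<open>m p\<close>.\<close>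
  have slope: "ennreal \<bar>T' (m p) * (\<Sum>i\<in>UNIV. y $ i * dm i p)\<bar> \<le> of_nat CARD('n) * ennreal (norm y) * A p" for p y
  proof (cases "cbox (p - (\<chi> i. r)) (p + (\<chi> i. r)) \<subseteq> \<Omega>")
    case True
    have "\<bar>T' (m p) * (\<Sum>i\<in>UNIV. y $ i * dm i p)\<bar> \<le> 1 * (\<Sum>i\<in>UNIV. \<bar>y $ i * dm i p\<bar>)"
      by (subst abs_mult, intro mult_mono T'(1) sum_abs) auto
    also have "\<dots> \<le> (\<Sum>i\<in>UNIV. norm y * \<bar>dm i p\<bar>)"
      by (auto simp: abs_mult intro!: sum_mono mult_right_mono component_le_norm_cart)
    finally have "ennreal \<bar>T' (m p) * (\<Sum>i\<in>UNIV. y $ i * dm i p)\<bar> \<le> ennreal (\<Sum>i\<in>UNIV. norm y * \<bar>dm i p\<bar>)"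
      by (rule ennreal_leI)
    also have "\<dots> = (\<Sum>i\<in>UNIV. ennreal (norm y) * ennreal \<bar>dm i p\<bar>)"
      by (subst sum_ennreal[symmetric]) (auto simp: ennreal_mult)
    also have "\<dots> \<le> (\<Sum>i\<in>(UNIV::'n set). ennreal (norm y) * A p)"
      unfolding A_def dm_def
      by (intro sum_mono mult_left_mono
          mollified_partial_bound[OF \<Omega>(1) u u0 ab weak H H_meas H0 \<psi>(1-3) True]) auto
    also have "\<dots> = of_nat CARD('n) * ennreal (norm y) * A p"
      by (simp add: mult.assoc)
    finally show ?thesis .
  next
    case False
    then obtain q where q: "q \<in> cbox (p - (\<chi> i. r)) (p + (\<chi> i. r))" "q \<notin> \<Omega>" by blast
    have "\<bar>(p - q) $ i\<bar> \<le> r" for i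
    proof -
      have "p $ i - r \<le> q $ i \<and> q $ i \<le> p $ i + r"
        using q(1) by (simp add: mem_box_cart)
      then show ?thesis by (simp add: abs_le_iff)
    qed
    then have "\<bar>u p - u q\<bar> < \<kappa>" by (intro d near)
    then have "\<bar>m p\<bar> \<le> 2 * \<kappa>" using u0[OF q(2)] m_close[of p] by linarith
    then show ?thesis using T'(2) by simp
  qed
  show ?thesis
  proof
    show "ennreal \<bar>u (x + y) - u x\<bar> \<le> ennreal \<eta> + of_nat CARD('n) * ennreal (norm y) *
       (\<integral>\<^sup>+t. (\<integral>\<^sup>+z. ennreal (H (x + t *\<^sub>R y - z)) * ennreal (\<psi> z) \<partial>lborel) * indicator {0..1} t \<partial>lborel)" for x y
    proof -
      define k where "k = (\<lambda>t. T' (m (x + t *\<^sub>R y)) * (\<Sum>i\<in>UNIV. y $ i * dm i (x + t *\<^sub>R y)))"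
      have m_deriv: "((\<lambda>t. m (x + t *\<^sub>R y)) has_real_derivative (\<Sum>i\<in>UNIV. y $ i * dm i (x + t *\<^sub>R y))) (at t)" for t
        unfolding m_def dm_def by (rule mollified_line_deriv(1)[OF u \<psi>(1)])
      have dm_cont: "continuous_on UNIV (dm i)" for i
        unfolding dm_def by (rule mollified_line_deriv(2)[OF u \<psi>(1)])
      have line_cont: "continuous_on UNIV (\<lambda>t. m (x + t *\<^sub>R y))"
        by (intro continuous_at_imp_continuous_on ballI DERIV_isCont[OF m_deriv])
      have k_cont: "continuous_on {0..1} k"
        unfolding k_def
        by (intro continuous_intros continuous_on_compose2[OF T'(3)] continuous_on_compose2[OF dm_cont]
            continuous_on_subset[OF line_cont]) auto
      have "((\<lambda>t. T (m (x + t *\<^sub>R y))) has_real_derivative k t) (at t within {0..1})" for t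
        unfolding k_def using DERIV_chain'[OF m_deriv T(1)]
        by (rule has_field_derivative_at_within)
      then have "(k has_integral T (m (x + 1 *\<^sub>R y)) - T (m (x + 0 *\<^sub>R y))) {0..1}"
        by (intro fundamental_theorem_of_calculus)
          (simp_all only: has_real_derivative_iff_has_vector_derivative[symmetric] zero_le_one)
      then have int_k: "integral {0..1} k = T (m (x + y)) - T (m x)"
        by (simp add: integral_unique)
      have abs_int: "((\<lambda>t. \<bar>k t\<bar>) has_integral integral {0..1} (\<lambda>t. \<bar>k t\<bar>)) {0..1}"
        using k_cont by (intro integrable_integral integrable_continuous_interval continuous_intros)
      have "\<bar>T (m (x + y)) - T (m x)\<bar> \<le> integral {0..1} (\<lambda>t. \<bar>k t\<bar>)"
        unfolding int_k[symmetric] real_norm_def[symmetric]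
        by (rule integral_norm_bound_integral)
          (use k_cont in \<open>auto intro!: integrable_continuous_interval continuous_intros\<close>)
      then have "ennreal \<bar>T (m (x + y)) - T (m x)\<bar> \<le> ennreal (integral {0..1} (\<lambda>t. \<bar>k t\<bar>))"
        by (rule ennreal_leI)
      also have "\<dots> = (\<integral>\<^sup>+t. ennreal \<bar>k t\<bar> * indicator {0..1} t \<partial>lborel)"
        using nn_integral_has_integral_lebesgue'[OF _ abs_int] by simp
      also have "\<dots> \<le> (\<integral>\<^sup>+t. of_nat CARD('n) * ennreal (norm y) * (A (x + t *\<^sub>R y) * indicator {0..1} t) \<partial>lborel)"
        by (rule nn_integral_mono) (use slope in \<open>auto simp: k_def indicator_def\<close>)
      also have "\<dots> = of_nat CARD('n) * ennreal (norm y) * (\<integral>\<^sup>+t. A (x + t *\<^sub>R y) * indicator {0..1} t \<partial>lborel)"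
        unfolding A_def by (rule nn_integral_cmult) measurable
      finally have main: "ennreal \<bar>T (m (x + y)) - T (m x)\<bar> \<le> \<dots>" .
      have "\<bar>u (x + y) - u x\<bar> \<le> \<eta> + \<bar>T (m (x + y)) - T (m x)\<bar>"
        using m_close[of x] m_close[of "x + y"] T(2)[of "m x"] T(2)[of "m (x + y)"]
        unfolding \<kappa>_def by linarith
      then have "ennreal \<bar>u (x + y) - u x\<bar> \<le> ennreal (\<eta> + \<bar>T (m (x + y)) - T (m x)\<bar>)"
        by (rule ennreal_leI)
      also have "\<dots> = ennreal \<eta> + ennreal \<bar>T (m (x + y)) - T (m x)\<bar>"
        using \<eta> by (intro ennreal_plus) auto
      finally show ?thesis
        using main unfolding A_def by (meson add_left_mono order_trans)
    qed
  qed (use c0 \<psi> in auto)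
qed

section \<open>Integrating the increment against a weight\<close>

text \<open>Young's inequality for \<open>f / a\<close> and \<open>g / b\<close>, integrated. The factors \<open>a\<close> and \<open>b\<close> are arbitrary upper bounds for the
  norms, which spares the case distinction for vanishing or infinite norms.\<close>
lemma nn_integral_Hoelder:
  fixes f g :: "'a \<Rightarrow> real"
  assumes pq: "p > 1" "q > 1" "1 / p + 1 / q = 1"
    and [measurable]: "f \<in> borel_measurable M" "g \<in> borel_measurable M"
    and nonneg: "\<And>x. f x \<ge> 0" "\<And>x. g x \<ge> 0" and ab: "a > 0" "b > 0"
    and f: "(\<integral>\<^sup>+x. ennreal (f x powr p) \<partial>M) \<le> ennreal (a powr p)"
    and g: "(\<integral>\<^sup>+x. ennreal (g x powr q) \<partial>M) \<le> ennreal (b powr q)"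
  shows "(\<integral>\<^sup>+x. ennreal (f x * g x) \<partial>M) \<le> ennreal (a * b)"
proof -
  define \<alpha> where "\<alpha> = a * b / (p * a powr p)"
  define \<beta> where "\<beta> = a * b / (q * b powr q)"
  have nn: "\<alpha> \<ge> 0" "\<beta> \<ge> 0" using pq ab by (auto simp: \<alpha>_def \<beta>_def)
  have "f x * g x \<le> \<alpha> * f x powr p + \<beta> * g x powr q" for x
  proof -
    have "f x / a * (g x / b) \<le> (f x / a) powr p / p + (g x / b) powr q / q"
      using nonneg ab pq by (intro Youngs_inequality) auto
    then have "a * b * (f x / a * (g x / b)) \<le> a * b * ((f x / a) powr p / p + (g x / b) powr q / q)"
      using ab by (intro mult_left_mono) auto
    then show ?thesis
      using ab nonneg by (simp add: \<alpha>_def \<beta>_def powr_divide field_simps)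
  qed
  then have "(\<integral>\<^sup>+x. ennreal (f x * g x) \<partial>M) \<le> (\<integral>\<^sup>+x. ennreal (\<alpha> * f x powr p + \<beta> * g x powr q) \<partial>M)"
    by (intro nn_integral_mono ennreal_leI)
  also have "\<dots> = ennreal \<alpha> * (\<integral>\<^sup>+x. ennreal (f x powr p) \<partial>M) + ennreal \<beta> * (\<integral>\<^sup>+x. ennreal (g x powr q) \<partial>M)"
    using nn by (simp add: ennreal_plus ennreal_mult nn_integral_add nn_integral_cmult)
  also have "\<dots> \<le> ennreal \<alpha> * ennreal (a powr p) + ennreal \<beta> * ennreal (b powr q)"
    by (intro add_mono mult_left_mono f g) auto
  also have "\<dots> = ennreal (\<alpha> * a powr p + \<beta> * b powr q)"
    using nn by (simp add: ennreal_plus ennreal_mult)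
  also have "\<alpha> * a powr p + \<beta> * b powr q = a * b * (1 / p + 1 / q)"
    using ab by (simp add: \<alpha>_def \<beta>_def field_simps)
  finally show ?thesis using pq by simp
qed

lemma nn_integral_homothety:
  fixes f :: "real^'n \<Rightarrow> ennreal"
  assumes [measurable]: "f \<in> borel_measurable borel" and t: "t > 0"
  shows "(\<integral>\<^sup>+y. f (x + t *\<^sub>R y) \<partial>lborel) = ennreal (t powr - real CARD('n)) * (\<integral>\<^sup>+y. f y \<partial>lborel)"
proof -
  have "(\<integral>\<^sup>+y. f y \<partial>lborel) =
      (\<integral>\<^sup>+y. f y \<partial>density (distr lborel borel (\<lambda>y. x + t *\<^sub>R y)) (\<lambda>_. \<bar>t\<bar> ^ DIM(real^'n)))"
    using t by (subst lborel_affine[of t x]) auto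
  also have "\<dots> = ennreal (t ^ CARD('n)) * (\<integral>\<^sup>+y. f (x + t *\<^sub>R y) \<partial>lborel)"
    using t by (subst nn_integral_density) (auto simp: nn_integral_distr nn_integral_cmult)
  also have "t ^ CARD('n) = t powr real CARD('n)"
    using t by (simp add: powr_realpow)
  finally have "ennreal (t powr - real CARD('n)) * (\<integral>\<^sup>+y. f y \<partial>lborel) =
      (ennreal (t powr - real CARD('n)) * ennreal (t powr real CARD('n))) * (\<integral>\<^sup>+y. f (x + t *\<^sub>R y) \<partial>lborel)"
    by (simp add: mult.assoc)
  also have "ennreal (t powr - real CARD('n)) * ennreal (t powr real CARD('n)) = 1"
    using t by (simp add: ennreal_mult[symmetric] powr_add[symmetric])
  finally show ?thesis by simp
qed

text \<open>The norm of \<open>H\<close> for the conjugate exponent is at most \<open>1\<close>. For \<open>p = 1\<close> the bound is required everywhere and not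
  only almost everywhere, as a majorant may be chosen constant.\<close>
definition conj_unit_bound :: "real \<Rightarrow> (real^'n \<Rightarrow> real) \<Rightarrow> bool" where
  "conj_unit_bound p H \<longleftrightarrow>
     (if p = 1 then \<forall>x. H x \<le> 1 else (\<integral>\<^sup>+x. ennreal (H x powr (p / (p - 1))) \<partial>lborel) \<le> 1)"

text \<open>Hoelder's inequality, where the homothety with ratio \<open>t\<close> costs \<open>t\<^bsup>-n/p'\<^esup>\<close> and \<open>n / p' = n (p - 1) / p\<close>.\<close>
lemma homothety_pairing_bound:
  fixes H \<delta> :: "real^'n \<Rightarrow> real"
  assumes p: "1 \<le> p" and H: "conj_unit_bound p H" "\<And>x. H x \<ge> 0"
    and [measurable]: "H \<in> borel_measurable borel" "\<delta> \<in> borel_measurable borel"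
    and a: "a > 0" "(\<integral>\<^sup>+y. ennreal ((\<bar>\<delta> y\<bar> * norm y) powr p) \<partial>lborel) \<le> ennreal (a powr p)"
    and t: "t > 0"
  shows "(\<integral>\<^sup>+y. ennreal (\<bar>\<delta> y\<bar> * norm y * H (x + t *\<^sub>R y)) \<partial>lborel)
     \<le> ennreal (a * t powr - (real CARD('n) * (p - 1) / p))"
proof (cases "p = 1")
  case True
  have "(\<integral>\<^sup>+y. ennreal (\<bar>\<delta> y\<bar> * norm y * H (x + t *\<^sub>R y)) \<partial>lborel)
     \<le> (\<integral>\<^sup>+y. ennreal ((\<bar>\<delta> y\<bar> * norm y) powr p) \<partial>lborel)"
    using H True
    by (intro nn_integral_mono ennreal_leI) (auto simp: conj_unit_bound_def intro!: mult_left_le)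
  also have "\<dots> \<le> ennreal a" using a True by simp
  finally show ?thesis using True t by simp
next
  case False
  define q where "q = p / (p - 1)"
  have p1: "p > 1" using p False by simp
  have q: "q > 1" "1 / p + 1 / q = 1" using p1 by (auto simp: q_def field_simps)
  define b where "b = t powr - (real CARD('n) * (p - 1) / p)"
  have "real CARD('n) * (p - 1) / p * q = real CARD('n)"
    using p1 by (simp add: q_def)
  then have bq: "b powr q = t powr - real CARD('n)"
    unfolding b_def powr_powr by simp
  have "(\<integral>\<^sup>+y. ennreal ((\<bar>\<delta> y\<bar> * norm y) * H (x + t *\<^sub>R y)) \<partial>lborel) \<le> ennreal (a * b)"
  proof (rule nn_integral_Hoelder[OF p1 q])
    have "(\<integral>\<^sup>+y. ennreal (H (x + t *\<^sub>R y) powr q) \<partial>lborel) =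
        ennreal (t powr - real CARD('n)) * (\<integral>\<^sup>+y. ennreal (H y powr q) \<partial>lborel)"
      by (rule nn_integral_homothety[OF _ t, where f = "\<lambda>y. ennreal (H y powr q)"]) simp
    also have "\<dots> \<le> ennreal (t powr - real CARD('n)) * 1"
      using H(1) False unfolding conj_unit_bound_def q_def by (intro mult_left_mono) auto
    finally show "(\<integral>\<^sup>+y. ennreal (H (x + t *\<^sub>R y) powr q) \<partial>lborel) \<le> ennreal (b powr q)"
      by (simp add: bq)
  qed (use H a t in \<open>auto simp: b_def\<close>)
  then show ?thesis by (simp add: b_def)
qed

lemma nn_integral_powr_unit_interval:
  fixes s :: real
  assumes "s < 1"
  shows "(\<integral>\<^sup>+t. ennreal (t powr - s) * indicator {0..1} t \<partial>lborel) = ennreal (1 / (1 - s))"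
proof -
  have "((\<lambda>t. t powr - s) has_integral (1 powr (- s + 1) / (- s + 1))) {0..1}"
    using assms by (intro has_integral_powr_from_0) auto
  then show ?thesis
    using nn_integral_has_integral_lebesgue'[of "{0..1}" "\<lambda>t. t powr - s"] by simp
qed

text \<open>The central estimate. After Tonelli's theorem the innermost integral is the one over \<open>y\<close>, bounded by
  \<open>homothety_pairing_bound\<close> independently of the centre \<open>x - z\<close>; so the average over \<open>z\<close> disappears, and what remains is
  the integral of \<open>t\<^bsup>-n/p'\<^esup>\<close> over the unit interval.\<close>
lemma weighted_increment_bound:
  fixes u H \<delta> :: "real^'n \<Rightarrow> real" and g :: "'n \<Rightarrow> real^'n \<Rightarrow> real"
  assumes \<Omega>: "open \<Omega>" "bounded \<Omega>"
    and u: "continuous_on UNIV u" and u0: "\<And>x. x \<notin> \<Omega> \<Longrightarrow> u x = 0"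
    and weak: "\<And>i \<psi>. \<psi> \<in> test_functions \<Omega> \<Longrightarrow>
       (LINT x|lebesgue_on \<Omega>. u x * partial_deriv i \<psi> x) = - (LINT x|lebesgue_on \<Omega>. g i x * \<psi> x)"
    and H: "\<And>i. AE x in lebesgue_on \<Omega>. \<bar>g i x\<bar> \<le> H x"
    and H_meas [measurable]: "H \<in> borel_measurable borel" and H0: "\<And>x. H x \<ge> 0"
    and p: "1 \<le> p" and s: "real CARD('n) * (p - 1) / p < 1" and Hp: "conj_unit_bound p H"
    and \<delta>: "integrable lborel \<delta>"
    and a: "a > 0" "(\<integral>\<^sup>+y. ennreal ((\<bar>\<delta> y\<bar> * norm y) powr p) \<partial>lborel) \<le> ennreal (a powr p)"
  shows "(\<integral>\<^sup>+y. ennreal (\<bar>\<delta> y\<bar> * \<bar>u (x + y) - u x\<bar>) \<partial>lborel)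
     \<le> ennreal (real CARD('n) / (1 - real CARD('n) * (p - 1) / p) * a)"
proof -
  define s where "s = real CARD('n) * (p - 1) / p"
  define N where "N = (LINT y|lborel. \<bar>\<delta> y\<bar>)"
  have N: "(\<integral>\<^sup>+y. ennreal \<bar>\<delta> y\<bar> \<partial>lborel) = ennreal N" "N \<ge> 0"
    unfolding N_def using \<delta> by (auto intro!: nn_integral_eq_integral)
  have [measurable]: "\<delta> \<in> borel_measurable borel" using \<delta> by auto
  have [measurable]: "u \<in> borel_measurable borel" using u by (rule borel_measurable_continuous_onI)
  have step: "(\<integral>\<^sup>+y. ennreal (\<bar>\<delta> y\<bar> * \<bar>u (x + y) - u x\<bar>) \<partial>lborel)
      \<le> ennreal (real CARD('n) / (1 - s) * a) + ennreal (\<eta> * N)" if \<eta>: "\<eta> > 0" for \<eta>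
  proof -
    obtain \<psi> where \<psi>: "continuous_on UNIV \<psi>" "\<And>z. \<psi> z \<ge> 0" "(\<integral>\<^sup>+z. ennreal (\<psi> z) \<partial>lborel) = 1"
      and inc: "\<And>x y. ennreal \<bar>u (x + y) - u x\<bar> \<le> ennreal \<eta> + of_nat CARD('n) * ennreal (norm y) *
       (\<integral>\<^sup>+t. (\<integral>\<^sup>+z. ennreal (H (x + t *\<^sub>R y - z)) * ennreal (\<psi> z) \<partial>lborel) * indicator {0..1} t \<partial>lborel)"
      by (rule zero_extension_increment[OF \<Omega> u u0 weak H H_meas H0 \<eta>]; (assumption | rule that; assumption))
    have [measurable]: "\<psi> \<in> borel_measurable borel" using \<psi>(1) by (rule borel_measurable_continuous_onI)
    define \<Phi> where "\<Phi> = (\<lambda>y t z. ennreal (\<bar>\<delta> y\<bar> * norm y * H ((x - z) + t *\<^sub>R y)) * ennreal (\<psi> z) * indicator {0..1} t)"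
    have \<Phi>: "ennreal \<bar>\<delta> y\<bar> * (ennreal (norm y) *
        (\<integral>\<^sup>+t. (\<integral>\<^sup>+z. ennreal (H (x + t *\<^sub>R y - z)) * ennreal (\<psi> z) \<partial>lborel) * indicator {0..1} t \<partial>lborel)) =
        (\<integral>\<^sup>+t. \<integral>\<^sup>+z. \<Phi> y t z \<partial>lborel \<partial>lborel)" for y
    proof -
      have "(\<integral>\<^sup>+t. \<integral>\<^sup>+z. \<Phi> y t z \<partial>lborel \<partial>lborel) =
        (\<integral>\<^sup>+t. \<integral>\<^sup>+z. (ennreal \<bar>\<delta> y\<bar> * ennreal (norm y)) * indicator {0..1} t *
           (ennreal (H (x + t *\<^sub>R y - z)) * ennreal (\<psi> z)) \<partial>lborel \<partial>lborel)"
        unfolding \<Phi>_def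
      proof (intro nn_integral_cong)
        fix t z
        have eq1: "x - z + t *\<^sub>R y = x + t *\<^sub>R y - z" by simp
        have eq2: "ennreal (\<bar>\<delta> y\<bar> * norm y * H q) = ennreal \<bar>\<delta> y\<bar> * ennreal (norm y) * ennreal (H q)" for q
          using H0[of q] by (simp add: ennreal_mult)
        show "ennreal (\<bar>\<delta> y\<bar> * norm y * H ((x - z) + t *\<^sub>R y)) * ennreal (\<psi> z) * indicator {0..1} t =
          (ennreal \<bar>\<delta> y\<bar> * ennreal (norm y)) * indicator {0..1} t *
           (ennreal (H (x + t *\<^sub>R y - z)) * ennreal (\<psi> z))"
          unfolding eq1 eq2 by (simp only: mult_ac)
      qed
      also have "\<dots> = (\<integral>\<^sup>+t. (ennreal \<bar>\<delta> y\<bar> * ennreal (norm y)) * ((\<integral>\<^sup>+z. ennreal (H (x + t *\<^sub>R y - z)) * ennreal (\<psi> z) \<partial>lborel)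
          * indicator {0..1} t) \<partial>lborel)"
        by (intro nn_integral_cong, subst nn_integral_cmult) (measurable, simp add: mult.assoc mult.commute[of "indicator {0..1} _"])
      also have "\<dots> = (ennreal \<bar>\<delta> y\<bar> * ennreal (norm y)) * (\<integral>\<^sup>+t. (\<integral>\<^sup>+z. ennreal (H (x + t *\<^sub>R y - z)) * ennreal (\<psi> z) \<partial>lborel)
          * indicator {0..1} t \<partial>lborel)"
        by (rule nn_integral_cmult) measurable
      finally show ?thesis by (simp add: mult.assoc)
    qed
    have "(\<integral>\<^sup>+y. \<integral>\<^sup>+t. \<integral>\<^sup>+z. \<Phi> y t z \<partial>lborel \<partial>lborel \<partial>lborel) = (\<integral>\<^sup>+t. \<integral>\<^sup>+y. \<integral>\<^sup>+z. \<Phi> y t z \<partial>lborel \<partial>lborel \<partial>lborel)"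
      by (rule lborel_pair.Fubini') (unfold \<Phi>_def, measurable)
    also have "\<dots> = (\<integral>\<^sup>+t. \<integral>\<^sup>+z. \<integral>\<^sup>+y. \<Phi> y t z \<partial>lborel \<partial>lborel \<partial>lborel)"
      by (rule nn_integral_cong, rule lborel_pair.Fubini') (unfold \<Phi>_def, measurable)
    also have "\<dots> \<le> (\<integral>\<^sup>+t. \<integral>\<^sup>+z. (ennreal a * (ennreal (t powr - s) * indicator {0..1} t)) * ennreal (\<psi> z) \<partial>lborel \<partial>lborel)"
    \<comment> \<open>The homothety degenerates at \<open>t = 0\<close>, a null set.\<close>
    proof (rule nn_integral_mono_AE, rule eventually_mono[OF AE_lborel_singleton[of 0]])
      fix t :: real assume "t \<noteq> 0"
      show "(\<integral>\<^sup>+z. \<integral>\<^sup>+y. \<Phi> y t z \<partial>lborel \<partial>lborel)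
          \<le> (\<integral>\<^sup>+z. (ennreal a * (ennreal (t powr - s) * indicator {0..1} t)) * ennreal (\<psi> z) \<partial>lborel)"
      proof (cases "t \<in> {0..1}")
        case True
        with \<open>t \<noteq> 0\<close> have t: "t > 0" by simp
        show ?thesis
        proof (rule nn_integral_mono)
          fix z :: "real^'n"
          have "(\<integral>\<^sup>+y. \<Phi> y t z \<partial>lborel) = (\<integral>\<^sup>+y. ennreal (\<bar>\<delta> y\<bar> * norm y * H ((x - z) + t *\<^sub>R y)) \<partial>lborel) * ennreal (\<psi> z)"
            unfolding \<Phi>_def using True by (simp add: nn_integral_multc)
          also have "\<dots> \<le> ennreal (a * t powr - s) * ennreal (\<psi> z)"
            unfolding s_def by (intro mult_right_mono homothety_pairing_bound p Hp H0 a t) auto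
          finally show "(\<integral>\<^sup>+y. \<Phi> y t z \<partial>lborel) \<le> (ennreal a * (ennreal (t powr - s) * indicator {0..1} t)) * ennreal (\<psi> z)"
            using True a(1) by (simp add: ennreal_mult)
        qed
      qed (simp add: \<Phi>_def)
    qed
    also have "\<dots> = (\<integral>\<^sup>+t. ennreal a * (ennreal (t powr - s) * indicator {0..1} t) \<partial>lborel)"
      by (simp add: nn_integral_cmult \<psi>(3))
    also have "\<dots> = ennreal a * ennreal (1 / (1 - s))"
      using assms(10) nn_integral_powr_unit_interval[of s] by (simp add: nn_integral_cmult s_def)
    finally have triple: "(\<integral>\<^sup>+y. \<integral>\<^sup>+t. \<integral>\<^sup>+z. \<Phi> y t z \<partial>lborel \<partial>lborel \<partial>lborel) \<le> ennreal a * ennreal (1 / (1 - s))" .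
    have "(\<integral>\<^sup>+y. ennreal (\<bar>\<delta> y\<bar> * \<bar>u (x + y) - u x\<bar>) \<partial>lborel)
      \<le> (\<integral>\<^sup>+y. ennreal \<eta> * ennreal \<bar>\<delta> y\<bar> + of_nat CARD('n) * (\<integral>\<^sup>+t. \<integral>\<^sup>+z. \<Phi> y t z \<partial>lborel \<partial>lborel) \<partial>lborel)"
    proof (rule nn_integral_mono)
      fix y
      have "ennreal (\<bar>\<delta> y\<bar> * \<bar>u (x + y) - u x\<bar>) = ennreal \<bar>\<delta> y\<bar> * ennreal \<bar>u (x + y) - u x\<bar>"
        by (simp add: ennreal_mult)
      also have "\<dots> \<le> ennreal \<bar>\<delta> y\<bar> * (ennreal \<eta> + of_nat CARD('n) * ennreal (norm y) *
       (\<integral>\<^sup>+t. (\<integral>\<^sup>+z. ennreal (H (x + t *\<^sub>R y - z)) * ennreal (\<psi> z) \<partial>lborel) * indicator {0..1} t \<partial>lborel))"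
        by (intro mult_left_mono inc) simp
      also have "\<dots> = ennreal \<eta> * ennreal \<bar>\<delta> y\<bar> + of_nat CARD('n) * (\<integral>\<^sup>+t. \<integral>\<^sup>+z. \<Phi> y t z \<partial>lborel \<partial>lborel)"
        unfolding \<Phi>[symmetric] by (simp add: distrib_left mult_ac)
      finally show "ennreal (\<bar>\<delta> y\<bar> * \<bar>u (x + y) - u x\<bar>) \<le> \<dots>" .
    qed
    also have "\<dots> = ennreal \<eta> * ennreal N + of_nat CARD('n) * (\<integral>\<^sup>+y. \<integral>\<^sup>+t. \<integral>\<^sup>+z. \<Phi> y t z \<partial>lborel \<partial>lborel \<partial>lborel)"
      by (subst nn_integral_add) (unfold \<Phi>_def, measurable, simp add: nn_integral_cmult N)
    also have "\<dots> \<le> ennreal \<eta> * ennreal N + of_nat CARD('n) * (ennreal a * ennreal (1 / (1 - s)))"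
      by (intro add_left_mono mult_left_mono triple) simp
    also have "\<dots> = ennreal (real CARD('n) / (1 - s) * a) + ennreal (\<eta> * N)"
    proof -
      have "s < 1" using assms(10) by (simp add: s_def)
      then have "of_nat CARD('n) * (ennreal a * ennreal (1 / (1 - s))) = ennreal (real CARD('n) / (1 - s) * a)"
        using a(1) by (simp add: ennreal_of_nat_eq_real_of_nat ennreal_mult[symmetric] mult.commute)
      then show ?thesis
        using N(2) \<eta> by (simp add: ennreal_mult add.commute)
    qed
    finally show ?thesis .
  qed
  show ?thesis unfolding s_def[symmetric]
  proof (rule ennreal_le_epsilon)
    fix e :: real assume e: "e > 0"
    have "e / (N + 1) * N \<le> e" "e / (N + 1) > 0"
      using e N(2) by (auto simp: field_simps)
    then show "(\<integral>\<^sup>+y. ennreal (\<bar>\<delta> y\<bar> * \<bar>u (x + y) - u x\<bar>) \<partial>lborel)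
      \<le> ennreal (real CARD('n) / (1 - s) * a) + ennreal e"
      using step[of "e / (N + 1)"] by (meson add_left_mono ennreal_leI order_trans)
  qed
qed

section \<open>Lebesgue norms and the dual unit ball\<close>

lemma Lp_norm_finite_exponent:
  "0 \<le> p \<Longrightarrow> Lp_norm (ennreal p) M f = (LINT x|M. norm (f x) powr p) powr (1 / p)"
  by (simp add: Lp_norm_def)

lemma nn_integral_powr_eq_Lp_norm:
  assumes "p > 0" "integrable M (\<lambda>x. norm (f x) powr p)"
  shows "(\<integral>\<^sup>+x. ennreal (norm (f x) powr p) \<partial>M) = ennreal (Lp_norm (ennreal p) M f powr p)"
proof -
  have "(\<integral>\<^sup>+x. ennreal (norm (f x) powr p) \<partial>M) = ennreal (LINT x|M. norm (f x) powr p)"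
    using assms by (intro nn_integral_eq_integral) auto
  moreover have "(LINT x|M. norm (f x) powr p) \<ge> 0" by (intro Bochner_Integration.integral_nonneg) auto
  ultimately show ?thesis
    using assms by (simp add: Lp_norm_finite_exponent powr_powr)
qed

lemma Lp_norm_nonneg: "Lp_norm s M f \<ge> 0"
  by (simp add: Lp_norm_def)

text \<open>The estimates are proved for every positive upper bound \<open>a\<close> of a norm; here the norm itself, possibly zero,
  is recovered in the limit.\<close>
lemma le_mult_if_le_mult_greater:
  fixes z c r :: real
  assumes c: "c \<ge> 0" and le: "\<And>a. a > r \<Longrightarrow> z \<le> c * a"
  shows "z \<le> c * r"
proof (rule field_le_epsilon)
  fix e :: real assume e: "e > 0"
  have "z \<le> c * (r + e / (c + 1))"
    using c e by (intro le) auto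
  also have "\<dots> \<le> c * r + e"
    using c e by (simp add: field_simps)
  finally show "z \<le> c * r + e" .
qed

text \<open>Hoelder's inequality against the constant \<open>1\<close>. The factor \<open>measure M (space M) + 1\<close> dominates every power of the
  total mass with exponent in \<open>[0, 1]\<close>, so it serves all exponents, including \<open>p = 1\<close>.\<close>
lemma L1_le_Lp_norm:
  fixes F :: "'a \<Rightarrow> 'b::euclidean_space"
  assumes M: "finite_measure M" and p: "1 \<le> p" and F: "F \<in> Lp_space (ennreal p) M"
  shows "integrable M F" "(LINT x|M. norm (F x)) \<le> (measure M (space M) + 1) * Lp_norm (ennreal p) M F"
proof -
  have [measurable]: "F \<in> borel_measurable M" and int: "integrable M (\<lambda>x. norm (F x) powr p)"
    using F p by (auto simp: Lp_space_def)
  define m where "m = measure M (space M) + 1"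
  have m: "m \<ge> 1" by (simp add: m_def)
  have le: "(\<integral>\<^sup>+x. ennreal (norm (F x)) \<partial>M) \<le> ennreal (m * a)" if a: "a > Lp_norm (ennreal p) M F" for a
  proof -
    have a0: "a > 0" using a Lp_norm_nonneg[of "ennreal p" M F] by linarith
    have "(\<integral>\<^sup>+x. ennreal (norm (F x) powr p) \<partial>M) = ennreal (Lp_norm (ennreal p) M F powr p)"
      using p by (intro nn_integral_powr_eq_Lp_norm int) auto
    also have "\<dots> \<le> ennreal (a powr p)"
      using a p by (intro ennreal_leI powr_mono2 Lp_norm_nonneg) auto
    finally have Fp: "(\<integral>\<^sup>+x. ennreal (norm (F x) powr p) \<partial>M) \<le> ennreal (a powr p)" .
    show ?thesis
    proof (cases "p = 1")
      case True
      then have "(\<integral>\<^sup>+x. ennreal (norm (F x)) \<partial>M) \<le> ennreal a" using Fp a0 by simp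
      also have "\<dots> \<le> ennreal (m * a)" using m a0 by (intro ennreal_leI) simp
      finally show ?thesis .
    next
      case False
      define q where "q = p / (p - 1)"
      have p1: "p > 1" using p False by simp
      have q: "q > 1" "1 / p + 1 / q = 1" using p1 by (auto simp: q_def field_simps)
      have "(\<integral>\<^sup>+x. ennreal (norm (F x) * 1) \<partial>M) \<le> ennreal (a * m)"
      proof (rule nn_integral_Hoelder[OF p1 q])
        have "(\<integral>\<^sup>+x. ennreal (1 powr q) \<partial>M) = ennreal (measure M (space M))"
          using finite_measure.emeasure_eq_measure[OF M] by simp
        also have "\<dots> \<le> ennreal (m powr q)"
        proof (rule ennreal_leI)
          have "measure M (space M) \<le> m powr 1" using m by (simp add: m_def)
          also have "\<dots> \<le> m powr q" using m q by (intro powr_mono) auto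
          finally show "measure M (space M) \<le> m powr q" .
        qed
        finally show "(\<integral>\<^sup>+x. ennreal (1 powr q) \<partial>M) \<le> ennreal (m powr q)" .
      qed (use Fp a0 m in auto)
      then show ?thesis by (simp add: mult.commute)
    qed
  qed
  have "(\<integral>\<^sup>+x. ennreal (norm (F x)) \<partial>M) < \<infinity>"
    using le[of "Lp_norm (ennreal p) M F + 1"] le_less_trans by fastforce
  then show i: "integrable M F"
    by (intro integrableI_bounded) auto
  have le2: "(LINT x|M. norm (F x)) \<le> m * a" if a: "a > Lp_norm (ennreal p) M F" for a
  proof -
    have "ennreal (LINT x|M. norm (F x)) \<le> ennreal (m * a)"
      using le[OF a] i by (subst nn_integral_eq_integral[symmetric]) auto
    moreover have "m * a \<ge> 0" using m a Lp_norm_nonneg[of "ennreal p" M F] by simp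
    ultimately show ?thesis by simp
  qed
  have "0 \<le> m" using m by simp
  from le_mult_if_le_mult_greater[OF this le2]
  show "(LINT x|M. norm (F x)) \<le> (measure M (space M) + 1) * Lp_norm (ennreal p) M F"
    unfolding m_def .
qed

lemma continuous_versions_agree:
  assumes \<Omega>: "open \<Omega>" and v: "continuous_version \<Omega> \<phi> v" and w: "continuous_version \<Omega> \<phi> w" and x: "x \<in> \<Omega>"
  shows "v x = w x"
proof (rule ccontr)
  assume ne: "v x \<noteq> w x"
  have "continuous_on (closure \<Omega>) v" "continuous_on (closure \<Omega>) w"
    using v w unfolding continuous_version_def by simp_all
  note this[THEN continuous_on_subset, OF closure_subset]
  then have cont: "continuous_on \<Omega> v" "continuous_on \<Omega> w" .
  have "open (\<Omega> \<inter> (\<lambda>x. norm (v x - w x)) -` {0<..})"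
    using \<Omega> cont by (intro continuous_open_preimage continuous_intros) auto
  also have "\<Omega> \<inter> (\<lambda>x. norm (v x - w x)) -` {0<..} = {x \<in> \<Omega>. norm (v x - w x) > 0}"
    by auto
  finally have op: "open {x \<in> \<Omega>. norm (v x - w x) > 0}" .
  have "AE x in lebesgue_on \<Omega>. \<phi> x = v x" "AE x in lebesgue_on \<Omega>. \<phi> x = w x"
    using v w unfolding continuous_version_def by auto
  then have "AE x in lebesgue_on \<Omega>. v x = w x"
    by eventually_elim simp
  then have "AE x in lebesgue. x \<in> \<Omega> \<longrightarrow> v x = w x"
    using \<Omega> by (subst (asm) AE_restrict_space_iff) auto
  then have "AE x in lebesgue. x \<notin> {x \<in> \<Omega>. norm (v x - w x) > 0}"
    by (auto elim!: eventually_mono)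
  then have "{x \<in> \<Omega>. norm (v x - w x) > 0} \<in> null_sets lebesgue"
    using op by (subst AE_iff_null_sets) auto
  then have "{x \<in> \<Omega>. norm (v x - w x) > 0} = {}"
    using op open_not_negligible negligible_iff_null_sets by blast
  with ne x show False by auto
qed

lemma zero_extension_continuous:
  assumes \<Omega>: "open \<Omega>" and w: "continuous_on (closure \<Omega>) w" "\<And>x. x \<in> frontier \<Omega> \<Longrightarrow> w x = 0"
  shows "continuous_on UNIV (\<lambda>x. if x \<in> \<Omega> then w x else 0)"
proof -
  have "continuous_on (closure \<Omega> \<union> - \<Omega>) (\<lambda>x. if x \<in> \<Omega> then w x else 0)"
    using \<Omega> w by (intro continuous_on_If) (auto simp: frontier_def interior_open)
  moreover have "closure \<Omega> \<union> - \<Omega> = UNIV" using closure_subset by auto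
  ultimately show ?thesis by simp
qed

text \<open>Lebesgue measurable gradients are replaced by Borel functions because compositions such as
  \<open>H (x + t *\<^sub>R y - z)\<close> are jointly measurable only for Borel \<open>H\<close>.\<close>
lemma borel_majorant:
  fixes G :: "real^'n \<Rightarrow> 'b::euclidean_space"
  assumes \<Omega>: "\<Omega> \<in> sets lebesgue" and p: "1 \<le> p"
    and G: "G \<in> Lp_space (conj_exponent p) (lebesgue_on \<Omega>)"
      "Lp_norm (conj_exponent p) (lebesgue_on \<Omega>) G \<le> 1"
  obtains H where "H \<in> borel_measurable borel" "\<And>x. H x \<ge> 0" "conj_unit_bound p H"
    "AE x in lebesgue_on \<Omega>. norm (G x) \<le> H x"
proof (cases "p = 1")
  case True
  have "Linf_norm (lebesgue_on \<Omega>) G < \<infinity>" "enn2real (Linf_norm (lebesgue_on \<Omega>) G) \<le> 1"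
    using G True by (auto simp: Lp_space_def Lp_norm_def conj_exponent_def)
  then have le1: "Linf_norm (lebesgue_on \<Omega>) G \<le> 1"
    by (cases "Linf_norm (lebesgue_on \<Omega>) G") (auto simp: ennreal_le_1)
  have "AE x in lebesgue_on \<Omega>. ennreal (norm (G x)) \<le> Linf_norm (lebesgue_on \<Omega>) G"
    unfolding Linf_norm_def by (rule esssup_AE)
  then have "AE x in lebesgue_on \<Omega>. norm (G x) \<le> 1"
  proof (rule eventually_mono)
    fix x assume "ennreal (norm (G x)) \<le> Linf_norm (lebesgue_on \<Omega>) G"
    then have "ennreal (norm (G x)) \<le> 1" using le1 by (rule order_trans)
    then show "norm (G x) \<le> 1" by (simp add: ennreal_le_1)
  qed
  then show ?thesis
    using True by (intro that[of "\<lambda>_. 1"]) (auto simp: conj_unit_bound_def)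
next
  case False
  define q where "q = p / (p - 1)"
  have q: "q > 1" using p False by (simp add: q_def field_simps)
  have conj: "conj_exponent p = ennreal q" using False by (simp add: conj_exponent_def q_def)
  have G_meas [measurable]: "G \<in> borel_measurable (lebesgue_on \<Omega>)"
    and int: "integrable (lebesgue_on \<Omega>) (\<lambda>x. norm (G x) powr q)"
    using G(1) q unfolding conj Lp_space_def by auto
  define N where "N x = (if x \<in> \<Omega> then norm (G x) else 0)" for x
  have [measurable]: "N \<in> borel_measurable (completion lborel)"
    unfolding N_def using \<Omega> by (intro borel_measurable_if_I) auto
  obtain H where H [measurable]: "H \<in> borel_measurable lborel" and NH: "AE x in lborel. N x = H x"
    using completion_ex_borel_measurable_real[of N lborel] by auto
  have NH': "AE x in lebesgue. N x = H x" using NH by (rule AE_completion)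
  have "(\<integral>\<^sup>+x. ennreal (\<bar>H x\<bar> powr q) \<partial>lborel) = (\<integral>\<^sup>+x. ennreal (\<bar>H x\<bar> powr q) \<partial>lebesgue)"
    by (rule nn_integral_completion[symmetric])
  also have "\<dots> = (\<integral>\<^sup>+x. ennreal (norm (G x) powr q) * indicator \<Omega> x \<partial>lebesgue)"
  proof (rule nn_integral_cong_AE, rule eventually_mono[OF NH'])
    fix x assume "N x = H x"
    then have "\<bar>H x\<bar> = (if x \<in> \<Omega> then norm (G x) else 0)"
      unfolding N_def by (metis abs_norm_cancel abs_zero)
    then show "ennreal (\<bar>H x\<bar> powr q) = ennreal (norm (G x) powr q) * indicator \<Omega> x"
      using q by (simp add: indicator_def)
  qed
  also have "\<dots> = (\<integral>\<^sup>+x. ennreal (norm (G x) powr q) \<partial>lebesgue_on \<Omega>)"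
    using \<Omega> by (subst nn_integral_restrict_space) auto
  also have "\<dots> = ennreal (Lp_norm (ennreal q) (lebesgue_on \<Omega>) G powr q)"
    using q by (intro nn_integral_powr_eq_Lp_norm int) auto
  also have "\<dots> \<le> ennreal (1 powr q)"
    using G(2) q unfolding conj by (intro ennreal_leI powr_mono2 Lp_norm_nonneg) auto
  finally have bound: "(\<integral>\<^sup>+x. ennreal (\<bar>H x\<bar> powr q) \<partial>lborel) \<le> 1" by simp
  have "AE x in lebesgue. x \<in> \<Omega> \<longrightarrow> norm (G x) \<le> \<bar>H x\<bar>"
    using NH' by (rule eventually_mono) (auto simp: N_def)
  then have "AE x in lebesgue_on \<Omega>. norm (G x) \<le> \<bar>H x\<bar>"
    using \<Omega> by (subst AE_restrict_space_iff) auto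
  then show ?thesis
    using bound False H by (intro that[of "\<lambda>x. \<bar>H x\<bar>"]) (auto simp: conj_unit_bound_def q_def)
qed

text \<open>Everything that the estimates need to know about an element of the unit ball: its continuous zero extension,
  which agrees on \<open>\<Omega>\<close> with the chosen continuous representative, and a normalized majorant of a weak gradient.\<close>
lemma dual_unit_ball_zero_extension:
  fixes \<phi> :: "real^'n \<Rightarrow> real^'k"
  assumes \<Omega>: "open \<Omega>" and p: "1 \<le> p"
    and \<phi>: "\<phi> \<in> W1_0 (conj_exponent p) \<Omega>" "W1_norm (conj_exponent p) \<Omega> \<phi> \<le> 1"
  obtains w :: "real^'n \<Rightarrow> real^'k" and G H where
    "continuous_on UNIV w" "\<And>x. x \<notin> \<Omega> \<Longrightarrow> w x = 0" "\<And>x. x \<in> \<Omega> \<Longrightarrow> cont_rep \<Omega> \<phi> x = w x"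
    "\<phi> \<in> borel_measurable (lebesgue_on \<Omega>)" "AE x in lebesgue_on \<Omega>. \<phi> x = w x"
    "\<And>k i \<psi>. \<psi> \<in> test_functions \<Omega> \<Longrightarrow>
       (LINT x|lebesgue_on \<Omega>. w x $ k * partial_deriv i \<psi> x) = - (LINT x|lebesgue_on \<Omega>. G x $ k $ i * \<psi> x)"
    "\<And>k i. AE x in lebesgue_on \<Omega>. \<bar>G x $ k $ i\<bar> \<le> H x"
    "H \<in> borel_measurable borel" "\<And>x. H x \<ge> 0" "conj_unit_bound p H"
proof -
  let ?M = "lebesgue_on \<Omega>"
  have \<Omega>L: "\<Omega> \<in> sets lebesgue" using \<Omega> by simp
  obtain w0 where w0: "continuous_version \<Omega> \<phi> w0" "\<And>x. x \<in> frontier \<Omega> \<Longrightarrow> w0 x = 0"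
    and W1: "\<phi> \<in> W1 (conj_exponent p) \<Omega>"
    using \<phi>(1) unfolding W1_0_def by auto
  define w where "w = (\<lambda>x. if x \<in> \<Omega> then w0 x else 0)"
  define G where "G = (SOME G. G \<in> Lp_space (conj_exponent p) ?M \<and> weak_jacobian \<Omega> \<phi> G)"
  have G: "G \<in> Lp_space (conj_exponent p) ?M" "weak_jacobian \<Omega> \<phi> G"
    using W1 someI_ex[of "\<lambda>G. G \<in> Lp_space (conj_exponent p) ?M \<and> weak_jacobian \<Omega> \<phi> G"]
    unfolding W1_def G_def by auto
  have "Lp_norm (conj_exponent p) ?M G \<le> 1"
    using \<phi>(2) Lp_norm_nonneg[of "conj_exponent p" ?M \<phi>] unfolding W1_norm_def G_def[symmetric] by linarith
  then obtain H where H: "H \<in> borel_measurable borel" "\<And>x. H x \<ge> 0" "conj_unit_bound p H"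
      "AE x in ?M. norm (G x) \<le> H x"
    using borel_majorant[OF \<Omega>L p G(1)] by metis
  have cw: "continuous_on UNIV w"
    unfolding w_def using w0 \<Omega> by (intro zero_extension_continuous) (auto simp: continuous_version_def)
  have [measurable]: "\<phi> \<in> borel_measurable ?M" using W1 by (auto simp: W1_def Lp_space_def)
  have [measurable]: "f \<in> borel_measurable ?M" if "continuous_on UNIV f" for f :: "real^'n \<Rightarrow> real"
    using that \<Omega>L by (intro continuous_imp_measurable_on_sets_lebesgue) (auto intro: continuous_on_subset)
  have AEw: "AE x in ?M. \<phi> x = w x"
  proof -
    have "AE x in ?M. \<phi> x = w0 x" using w0(1) by (auto simp: continuous_version_def)
    moreover have "AE x in ?M. x \<in> \<Omega>" by (rule AE_I2) simp
    ultimately show ?thesis by eventually_elim (simp add: w_def)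
  qed
  show ?thesis
  proof (rule that[of w G H])
    show "cont_rep \<Omega> \<phi> x = w x" if "x \<in> \<Omega>" for x
    proof -
      have "continuous_version \<Omega> \<phi> (cont_rep \<Omega> \<phi>)"
        unfolding cont_rep_def using w0(1) by (rule someI[where P = "continuous_version \<Omega> \<phi>"])
      then show ?thesis
        using continuous_versions_agree[OF \<Omega> _ w0(1) that] that by (simp add: w_def)
    qed
    show "(LINT x|?M. w x $ k * partial_deriv i \<psi> x) = - (LINT x|?M. G x $ k $ i * \<psi> x)"
      if \<psi>: "\<psi> \<in> test_functions \<Omega>" for k i \<psi>
    proof -
      have "Ck_fun (Suc 0) \<psi>" using \<psi> unfolding test_functions_def by blast
      then have "continuous_on UNIV (partial_deriv i \<psi>)" by simp
      then have [measurable]: "partial_deriv i \<psi> \<in> borel_measurable ?M" by measurable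
      have "continuous_on UNIV (\<lambda>x. w x $ k)" using cw by (intro continuous_intros)
      then have [measurable]: "(\<lambda>x. w x $ k) \<in> borel_measurable ?M" by measurable
      have "(\<lambda>x. \<phi> x $ k) \<in> borel_measurable ?M"
        by (rule measurable_compose[OF \<open>\<phi> \<in> borel_measurable ?M\<close>])
          (intro borel_measurable_continuous_onI continuous_intros)
      then have "(LINT x|?M. w x $ k * partial_deriv i \<psi> x) = (LINT x|?M. \<phi> x $ k * partial_deriv i \<psi> x)"
        using AEw by (intro integral_cong_AE) (auto elim!: eventually_mono)
      also have "\<dots> = - (LINT x|?M. G x $ k $ i * \<psi> x)"
        using G(2) \<psi> unfolding weak_jacobian_def by blast
      finally show ?thesis .
    qed
    show "AE x in ?M. \<bar>G x $ k $ i\<bar> \<le> H x" for k i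
      using H(4)
    proof (rule eventually_mono)
      fix x assume "norm (G x) \<le> H x"
      moreover have "\<bar>G x $ k $ i\<bar> \<le> norm (G x $ k)" "norm (G x $ k) \<le> norm (G x)"
        by (simp_all add: component_le_norm_cart Finite_Cartesian_Product.norm_nth_le)
      ultimately show "\<bar>G x $ k $ i\<bar> \<le> H x" by linarith
    qed
  qed (use cw AEw H in \<open>auto simp: w_def\<close>)
qed

section \<open>The pointwise error of mollification\<close>

text \<open>The value that the weighted increment bound gives when the weight is the normalized indicator of the ball of radius \<open>1\<close>
  about \<open>c\<close>, on which \<open>norm y \<le> norm c + 1\<close>.\<close>
definition sup_bound :: "real^'n \<Rightarrow> real \<Rightarrow> real" where
  "sup_bound c p = real CARD('n) / (1 - real CARD('n) * (p - 1) / p) * ((norm c + 1) *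
     measure lborel (ball c 1) powr (1 / p)) / measure lborel (ball c 1)"

text \<open>If translating by elements of \<open>ball c 1\<close> leaves \<open>\<Omega>\<close>, then \<open>u (x + y) - u x = - u x\<close> on the support of the
  indicator of that ball, so averaging increments recovers \<open>u x\<close>.\<close>
lemma sup_norm_bound:
  fixes u H :: "real^'n \<Rightarrow> real" and g :: "'n \<Rightarrow> real^'n \<Rightarrow> real"
  assumes \<Omega>: "open \<Omega>" "bounded \<Omega>"
    and u: "continuous_on UNIV u" and u0: "\<And>x. x \<notin> \<Omega> \<Longrightarrow> u x = 0"
    and weak: "\<And>i \<psi>. \<psi> \<in> test_functions \<Omega> \<Longrightarrow>
       (LINT x|lebesgue_on \<Omega>. u x * partial_deriv i \<psi> x) = - (LINT x|lebesgue_on \<Omega>. g i x * \<psi> x)"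
    and H: "\<And>i. AE x in lebesgue_on \<Omega>. \<bar>g i x\<bar> \<le> H x"
    and H_meas: "H \<in> borel_measurable borel" and H0: "\<And>x. H x \<ge> 0"
    and p: "1 \<le> p" and s: "real CARD('n) * (p - 1) / p < 1" and Hp: "conj_unit_bound p H"
    and c: "\<And>x y. x \<in> \<Omega> \<Longrightarrow> y \<in> ball c 1 \<Longrightarrow> x + y \<notin> \<Omega>"
  shows "\<bar>u x\<bar> \<le> sup_bound c p"
proof -
  define V where "V = measure lborel (ball c 1)"
  define a where "a = (norm c + 1) * V powr (1 / p)"
  define C where "C = real CARD('n) / (1 - real CARD('n) * (p - 1) / p)"
  have C: "C \<ge> 0" using s by (simp add: C_def)
  have fin: "emeasure lborel (ball c 1) = ennreal V"
    unfolding V_def using emeasure_lborel_ball_finite[of c 1]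
    by (intro emeasure_eq_ennreal_measure) auto
  have "V > 0"
    unfolding V_def using content_ball_pos[of 1 c] by simp
  have a: "a > 0" using \<open>V > 0\<close> by (simp add: a_def add_nonneg_pos)
  show ?thesis
  proof (cases "x \<in> \<Omega>")
    case True
    let ?\<delta> = "indicator (ball c 1) :: real^'n \<Rightarrow> real"
    have "(\<integral>\<^sup>+y. ennreal ((\<bar>?\<delta> y\<bar> * norm y) powr p) \<partial>lborel)
        \<le> (\<integral>\<^sup>+y. ennreal ((norm c + 1) powr p) * indicator (ball c 1) y \<partial>lborel)"
    proof (rule nn_integral_mono)
      fix y :: "real^'n"
      show "ennreal ((\<bar>?\<delta> y\<bar> * norm y) powr p) \<le> ennreal ((norm c + 1) powr p) * indicator (ball c 1) y"
      proof (cases "y \<in> ball c 1")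
        case True
        then have "norm y \<le> norm c + 1"
          using norm_triangle_ineq2[of y c] by (simp add: dist_norm norm_minus_commute)
        then show ?thesis using True p by (auto intro!: ennreal_leI powr_mono2)
      qed simp
    qed
    also have "\<dots> = ennreal ((norm c + 1) powr p * V)"
      using \<open>V > 0\<close> by (simp add: nn_integral_cmult_indicator fin ennreal_mult)
    also have "(norm c + 1) powr p * V = a powr p"
      using p \<open>V > 0\<close> by (simp add: a_def powr_mult powr_powr)
    finally have ap: "(\<integral>\<^sup>+y. ennreal ((\<bar>?\<delta> y\<bar> * norm y) powr p) \<partial>lborel) \<le> ennreal (a powr p)" .
    have int: "integrable lborel ?\<delta>"
      using fin by (intro integrable_real_indicator) auto
    have "ennreal (\<bar>u x\<bar> * V) = (\<integral>\<^sup>+y. ennreal \<bar>u x\<bar> * indicator (ball c 1) y \<partial>lborel)"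
      using \<open>V > 0\<close> by (simp add: nn_integral_cmult_indicator fin ennreal_mult)
    also have "\<dots> = (\<integral>\<^sup>+y. ennreal (\<bar>?\<delta> y\<bar> * \<bar>u (x + y) - u x\<bar>) \<partial>lborel)"
      using u0 c[OF True] by (intro nn_integral_cong) (auto simp: indicator_def)
    also have "\<dots> \<le> ennreal (C * a)"
      unfolding C_def
      by (rule weighted_increment_bound[OF \<Omega> u u0 weak H H_meas H0 p s Hp int a ap])
    finally have "\<bar>u x\<bar> * V \<le> C * a" using C a by simp
    then show ?thesis
      using \<open>V > 0\<close> unfolding sup_bound_def V_def[symmetric] C_def[symmetric] a_def[symmetric]
      by (simp add: pos_le_divide_eq)
  next
    case False
    then show ?thesis
      using u0 C a \<open>V > 0\<close> unfolding sup_bound_def V_def[symmetric] C_def[symmetric] a_def[symmetric]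
      by simp
  qed
qed

lemma compact_support_integrable:
  fixes f :: "real^'n \<Rightarrow> 'b::euclidean_space"
  assumes f: "continuous_on UNIV f" and 0: "\<And>z. z \<notin> cball 0 R \<Longrightarrow> f z = 0"
  shows "integrable lborel f"
proof -
  have "integrable lborel (\<lambda>z. indicator (cball 0 R) z *\<^sub>R f z)"
    by (rule borel_integrable_compact) (auto intro: continuous_on_subset[OF f])
  moreover have "(\<lambda>z. indicator (cball 0 R) z *\<^sub>R f z) = f"
    using 0 by (auto simp: indicator_def fun_eq_iff)
  ultimately show ?thesis by simp
qed

text \<open>Split \<open>w x - \<integral> \<delta>(y) w(x + y) dy\<close> into the mass defect \<open>1 - \<integral> \<delta>\<close> times \<open>w x\<close> and the average of increments, and
  treat each component of the increments with the weighted bound.\<close>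
lemma mollification_error_bound:
  fixes w :: "real^'n \<Rightarrow> real^'k" and G :: "real^'n \<Rightarrow> real^'n^'k" and \<delta> H :: "real^'n \<Rightarrow> real"
  assumes \<Omega>: "open \<Omega>" "bounded \<Omega>"
    and w: "continuous_on UNIV w" and w0: "\<And>x. x \<notin> \<Omega> \<Longrightarrow> w x = 0"
    and weak: "\<And>k i \<psi>. \<psi> \<in> test_functions \<Omega> \<Longrightarrow>
       (LINT x|lebesgue_on \<Omega>. w x $ k * partial_deriv i \<psi> x) = - (LINT x|lebesgue_on \<Omega>. G x $ k $ i * \<psi> x)"
    and H: "\<And>k i. AE x in lebesgue_on \<Omega>. \<bar>G x $ k $ i\<bar> \<le> H x"
    and H_meas: "H \<in> borel_measurable borel" and H0: "\<And>x. H x \<ge> 0"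
    and p: "1 \<le> p" and s: "real CARD('n) * (p - 1) / p < 1" and Hp: "conj_unit_bound p H"
    and c: "\<And>x y. x \<in> \<Omega> \<Longrightarrow> y \<in> ball c 1 \<Longrightarrow> x + y \<notin> \<Omega>"
    and \<delta>: "continuous_on UNIV \<delta>" and \<delta>0: "\<And>y. y \<notin> cball 0 R \<Longrightarrow> \<delta> y = 0"
  shows "norm (w x - (LINT y|lborel. \<delta> y *\<^sub>R w (x + y))) \<le>
    real CARD('k) * sup_bound c p * \<bar>1 - (LINT y|lborel. \<delta> y)\<bar> +
    real CARD('k) * (real CARD('n) / (1 - real CARD('n) * (p - 1) / p)) * Lp_norm (ennreal p) lborel (\<lambda>y. \<delta> y *\<^sub>R y)"
proof -
  define C where "C = real CARD('n) / (1 - real CARD('n) * (p - 1) / p)"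
  have C: "C \<ge> 0" using s by (simp add: C_def)
  define \<rho> where "\<rho> = Lp_norm (ennreal p) lborel (\<lambda>y. \<delta> y *\<^sub>R y)"
  have wk: "continuous_on UNIV (\<lambda>x. w x $ k)" "\<And>x. x \<notin> \<Omega> \<Longrightarrow> w x $ k = 0" for k
    using w w0 by (auto intro!: continuous_intros)
  have int\<delta>: "integrable lborel \<delta>" by (rule compact_support_integrable[OF \<delta> \<delta>0])
  have intw: "integrable lborel (\<lambda>y. \<delta> y *\<^sub>R w (x + y))"
    using \<delta>0 by (intro compact_support_integrable[of _ R] continuous_intros \<delta> continuous_on_compose2[OF w]) auto
  have sup: "norm (w x) \<le> real CARD('k) * sup_bound c p"
  proof -
    have "norm (w x) \<le> (\<Sum>k\<in>UNIV. \<bar>w x $ k\<bar>)" by (rule norm_le_l1_cart)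
    also have "\<dots> \<le> (\<Sum>k\<in>(UNIV::'k set). sup_bound c p)"
      by (intro sum_mono sup_norm_bound[OF \<Omega> wk weak H H_meas H0 p s Hp c])
    finally show ?thesis by simp
  qed
  have incr: "norm (LINT y|lborel. \<delta> y *\<^sub>R (w (x + y) - w x)) \<le> (real CARD('k) * C) * a" if a: "a > \<rho>" for a
  proof -
    have \<rho>0: "\<rho> \<ge> 0" unfolding \<rho>_def by (rule Lp_norm_nonneg)
    with a have a0: "a > 0" by simp
    have "integrable lborel (\<lambda>y. norm (\<delta> y *\<^sub>R y) powr p)"
      using \<delta>0 p by (intro compact_support_integrable[of _ R] continuous_on_powr' continuous_intros \<delta>) auto
    then have "(\<integral>\<^sup>+y. ennreal (norm (\<delta> y *\<^sub>R y) powr p) \<partial>lborel) = ennreal (\<rho> powr p)"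
      unfolding \<rho>_def using p by (intro nn_integral_powr_eq_Lp_norm) auto
    also have "\<dots> \<le> ennreal (a powr p)"
      using a p \<rho>0 by (intro ennreal_leI powr_mono2) auto
    finally have ap: "(\<integral>\<^sup>+y. ennreal ((\<bar>\<delta> y\<bar> * norm y) powr p) \<partial>lborel) \<le> ennreal (a powr p)" by simp
    have [measurable]: "\<delta> \<in> borel_measurable borel" "(\<lambda>z. w z $ k) \<in> borel_measurable borel" for k
      using \<delta> wk by (auto intro: borel_measurable_continuous_onI)
    have "integrable lborel (\<lambda>y. \<delta> y *\<^sub>R (w (x + y) - w x))"
      using intw int\<delta> by (auto simp: scaleR_diff_right)
    then have "ennreal (norm (LINT y|lborel. \<delta> y *\<^sub>R (w (x + y) - w x)))
        \<le> (\<integral>\<^sup>+y. ennreal (norm (\<delta> y *\<^sub>R (w (x + y) - w x))) \<partial>lborel)"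
      by (rule integral_norm_bound_ennreal)
    also have "\<dots> \<le> (\<integral>\<^sup>+y. (\<Sum>k\<in>UNIV. ennreal (\<bar>\<delta> y\<bar> * \<bar>w (x + y) $ k - w x $ k\<bar>)) \<partial>lborel)"
    proof (rule nn_integral_mono)
      fix y
      have "norm (\<delta> y *\<^sub>R (w (x + y) - w x)) \<le> \<bar>\<delta> y\<bar> * (\<Sum>k\<in>UNIV. \<bar>w (x + y) $ k - w x $ k\<bar>)"
        using norm_le_l1_cart[of "w (x + y) - w x"] by (simp add: mult_left_mono)
      then have "ennreal (norm (\<delta> y *\<^sub>R (w (x + y) - w x))) \<le> ennreal (\<Sum>k\<in>UNIV. \<bar>\<delta> y\<bar> * \<bar>w (x + y) $ k - w x $ k\<bar>)"
        unfolding sum_distrib_left by (rule ennreal_leI)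
      also have "\<dots> = (\<Sum>k\<in>UNIV. ennreal (\<bar>\<delta> y\<bar> * \<bar>w (x + y) $ k - w x $ k\<bar>))"
        by (rule sum_ennreal[symmetric]) simp
      finally show "ennreal (norm (\<delta> y *\<^sub>R (w (x + y) - w x))) \<le> \<dots>" .
    qed
    also have "\<dots> = (\<Sum>k\<in>UNIV. \<integral>\<^sup>+y. ennreal (\<bar>\<delta> y\<bar> * \<bar>w (x + y) $ k - w x $ k\<bar>) \<partial>lborel)"
      by (rule nn_integral_sum) measurable
    also have "\<dots> \<le> (\<Sum>k\<in>(UNIV::'k set). ennreal (C * a))"
      unfolding C_def
      by (intro sum_mono weighted_increment_bound[OF \<Omega> wk weak H H_meas H0 p s Hp int\<delta> a0 ap])
    also have "\<dots> = ennreal ((real CARD('k) * C) * a)"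
      using C a0 by (simp add: ennreal_of_nat_eq_real_of_nat ennreal_mult[symmetric] mult.assoc)
    finally show ?thesis using C a0 by simp
  qed
  have "0 \<le> real CARD('k) * C" using C by simp
  from le_mult_if_le_mult_greater[OF this incr]
  have incr': "norm (LINT y|lborel. \<delta> y *\<^sub>R (w (x + y) - w x)) \<le> (real CARD('k) * C) * \<rho>" .
  have "(LINT y|lborel. \<delta> y *\<^sub>R (w (x + y) - w x)) =
      (LINT y|lborel. \<delta> y *\<^sub>R w (x + y)) - (LINT y|lborel. \<delta> y) *\<^sub>R w x"
    using intw int\<delta> by (simp add: scaleR_diff_right)
  then have "w x - (LINT y|lborel. \<delta> y *\<^sub>R w (x + y)) =
      (1 - (LINT y|lborel. \<delta> y)) *\<^sub>R w x - (LINT y|lborel. \<delta> y *\<^sub>R (w (x + y) - w x))"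
    by (simp add: algebra_simps)
  also have "norm \<dots> \<le> \<bar>1 - (LINT y|lborel. \<delta> y)\<bar> * norm (w x) + norm (LINT y|lborel. \<delta> y *\<^sub>R (w (x + y) - w x))"
    by (rule order_trans[OF norm_triangle_ineq4]) simp
  also have "\<dots> \<le> \<bar>1 - (LINT y|lborel. \<delta> y)\<bar> * (real CARD('k) * sup_bound c p) + (real CARD('k) * C) * \<rho>"
    by (intro add_mono mult_left_mono sup incr') simp
  finally show ?thesis unfolding C_def \<rho>_def by (simp add: mult_ac)
qed

section \<open>The force functional\<close>

lemma lborel_integral_translate:
  fixes f :: "real^'n \<Rightarrow> real"
  assumes [measurable]: "f \<in> borel_measurable borel"
  shows "(LINT y|lborel. f (x + y)) = (LINT y|lborel. f y)"
proof -
  have "(LINT y|lborel. f y) = (LINT y|distr lborel borel ((+) x). f y)"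
    by (simp add: lborel_distr_plus)
  also have "\<dots> = (LINT y|lborel. f (x + y))"
    by (rule integral_distr) auto
  finally show ?thesis ..
qed

lemma lebesgue_on_integral_translate:
  fixes f :: "real^'n \<Rightarrow> real"
  assumes \<Omega>: "\<Omega> \<in> sets lebesgue" and f: "f \<in> borel_measurable borel" "\<And>x. x \<notin> \<Omega> \<Longrightarrow> f x = 0"
  shows "(LINT z|lebesgue_on \<Omega>. f z) = (LINT y|lborel. f (x + y))"
proof -
  have "(LINT z|lebesgue_on \<Omega>. f z) = (LINT z|lebesgue. indicator \<Omega> z *\<^sub>R f z)"
    using \<Omega> by (subst integral_restrict_space[where M = lebesgue]) auto
  also have "\<dots> = (LINT z|lebesgue. f z)"
    using f(2) by (intro Bochner_Integration.integral_cong) (auto simp: indicator_def)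
  also have "\<dots> = (LINT z|lborel. f z)"
    using f(1) by (intro integral_completion) simp
  finally show ?thesis using lborel_integral_translate[OF f(1)] by simp
qed

text \<open>Exchanging the integrals over \<open>\<Theta>\<close> and \<open>\<Omega>\<close> and substituting \<open>x = X \<theta> + y\<close>. The substitution produces an
  integral over the whole space because \<open>w\<close> vanishes outside \<open>\<Omega>\<close>.\<close>
lemma force_difference_representation:
  fixes F X :: "real^'m \<Rightarrow> real^'n" and w :: "real^'n \<Rightarrow> real^'n"
  assumes \<Theta>: "finite_measure (lebesgue_on \<Theta>)" and \<Omega>: "open \<Omega>" "bounded \<Omega>"
    and X: "X \<in> borel_measurable (lebesgue_on \<Theta>)" "X ` \<Theta> \<subseteq> \<Omega>"
    and F: "integrable (lebesgue_on \<Theta>) F"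
    and w: "continuous_on UNIV w" "\<And>x. x \<notin> \<Omega> \<Longrightarrow> w x = 0" "\<And>x. x \<in> \<Omega> \<Longrightarrow> cont_rep \<Omega> \<phi> x = w x"
    and \<phi>: "\<phi> \<in> borel_measurable (lebesgue_on \<Omega>)" "AE x in lebesgue_on \<Omega>. \<phi> x = w x"
    and \<delta>: "continuous_on UNIV \<delta>" "\<And>y. y \<notin> cball 0 R \<Longrightarrow> \<delta> y = 0"
  defines "E \<equiv> \<lambda>x. w x - (LINT y|lborel. \<delta> y *\<^sub>R w (x + y))"
  shows "integrable (lebesgue_on \<Theta>) (\<lambda>\<theta>. F \<theta> \<bullet> E (X \<theta>))"
    and "force \<Omega> \<Theta> X F \<phi> - functional_of \<Omega> (reg_force \<Theta> X F \<delta>) \<phi> =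
      (LINT \<theta>|lebesgue_on \<Theta>. F \<theta> \<bullet> E (X \<theta>))"
proof -
  let ?T = "lebesgue_on \<Theta>" and ?O = "lebesgue_on \<Omega>"
  have \<Omega>L: "\<Omega> \<in> sets lebesgue" using \<Omega> by simp
  interpret T: finite_measure ?T by fact
  interpret O: finite_measure ?O
    using \<Omega> by (intro finite_measure_lebesgue_on) (simp add: bounded_set_imp_lmeasurable)
  interpret pair_sigma_finite ?T ?O ..
  have [measurable]: "\<delta> \<in> borel_measurable borel" "w \<in> borel_measurable borel"
    using \<delta> w by (auto intro: borel_measurable_continuous_onI)
  have [measurable]: "F \<in> borel_measurable ?T" using F by auto
  note X(1) [measurable] \<phi>(1) [measurable]
  have [measurable]: "(\<lambda>x. x) \<in> measurable ?O borel"
    using id_borel_measurable_lebesgue_on[of \<Omega>] by (simp add: id_def)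
  have bound: "\<exists>B. \<forall>x. norm (f x) \<le> B" if "continuous_on UNIV f" "\<And>x. x \<notin> cball 0 r \<Longrightarrow> f x = 0"
    for f :: "real^'n \<Rightarrow> 'b::real_normed_vector" and r
  proof -
    have "bounded (f ` cball 0 r)"
      using that(1) by (intro compact_imp_bounded compact_continuous_image) (auto intro: continuous_on_subset)
    then obtain B where B: "B > 0" "\<And>x. x \<in> cball 0 r \<Longrightarrow> norm (f x) \<le> B" unfolding bounded_pos by auto
    then have "norm (f x) \<le> B" for x using that(2)[of x] by (cases "x \<in> cball 0 r") auto
    then show ?thesis by blast
  qed
  obtain D where D: "\<And>y. \<bar>\<delta> y\<bar> \<le> D" using bound[OF \<delta>] by (auto simp only: real_norm_def)
  obtain r where "\<forall>x\<in>\<Omega>. norm x \<le> r" using \<Omega>(2) unfolding bounded_iff by blast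
  then have r: "\<Omega> \<subseteq> cball 0 r" by auto
  have "\<exists>S. \<forall>x. norm (w x) \<le> S"
    by (rule bound[OF w(1), of r]) (use w(2) r in blast)
  then obtain S where S: "\<And>x. norm (w x) \<le> S" by blast
  have DS: "D \<ge> 0" "S \<ge> 0"
    using order_trans[OF abs_ge_zero D[of 0]] order_trans[OF norm_ge_zero S[of 0]] by auto
  define f where "f = (\<lambda>\<theta> x. \<delta> (x - X \<theta>) * (F \<theta> \<bullet> w x))"
  have f_meas [measurable]: "(\<lambda>(\<theta>, x). f \<theta> x) \<in> borel_measurable (?T \<Otimes>\<^sub>M ?O)"
  proof -
    have [measurable]: "(\<lambda>z. snd z) \<in> measurable (?T \<Otimes>\<^sub>M ?O) borel"
      by (rule measurable_compose[OF measurable_snd \<open>(\<lambda>x. x) \<in> measurable ?O borel\<close>])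
    have [measurable]: "(\<lambda>z. X (fst z)) \<in> measurable (?T \<Otimes>\<^sub>M ?O) borel"
      by (rule measurable_compose[OF measurable_fst X(1)])
    have [measurable]: "(\<lambda>z. F (fst z)) \<in> measurable (?T \<Otimes>\<^sub>M ?O) borel"
      by (rule measurable_compose[OF measurable_fst \<open>F \<in> borel_measurable ?T\<close>])
    show ?thesis unfolding f_def split_beta by measurable
  qed
  have f_le: "norm (f \<theta> x) \<le> D * S * norm (F \<theta>)" for \<theta> x
  proof -
    have "\<bar>F \<theta> \<bullet> w x\<bar> \<le> norm (F \<theta>) * S"
      by (rule order_trans[OF Cauchy_Schwarz_ineq2]) (intro mult_left_mono S norm_ge_zero)
    then have "norm (f \<theta> x) \<le> D * (norm (F \<theta>) * S)"
      unfolding f_def real_norm_def abs_mult by (intro mult_mono D) (use DS in auto)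
    then show ?thesis by (simp add: mult_ac)
  qed
  have f_int: "integrable (?T \<Otimes>\<^sub>M ?O) (\<lambda>(\<theta>, x). f \<theta> x)"
  proof (rule Bochner_Integration.integrable_bound)
    show "integrable (?T \<Otimes>\<^sub>M ?O) (\<lambda>(\<theta>, x). D * S * norm (F \<theta>))"
    proof (rule Fubini_integrable)
      show "(\<lambda>(\<theta>, x). D * S * norm (F \<theta>)) \<in> borel_measurable (?T \<Otimes>\<^sub>M ?O)" by measurable
    qed (use F in auto)
    show "AE z in ?T \<Otimes>\<^sub>M ?O. norm (case z of (\<theta>, x) \<Rightarrow> f \<theta> x) \<le> norm (case z of (\<theta>, x) \<Rightarrow> D * S * norm (F \<theta>))"
      using f_le DS by (intro AE_I2) (auto simp: abs_mult)
  qed measurable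
  have f_slice: "integrable ?T (\<lambda>\<theta>. \<delta> (x - X \<theta>) *\<^sub>R F \<theta>)" for x
  proof (rule Bochner_Integration.integrable_bound)
    show "integrable ?T (\<lambda>\<theta>. D * norm (F \<theta>))" using F by auto
    show "AE \<theta> in ?T. norm (\<delta> (x - X \<theta>) *\<^sub>R F \<theta>) \<le> norm (D * norm (F \<theta>))"
      using D DS by (intro AE_I2) (auto simp: abs_mult intro!: mult_right_mono)
  qed measurable
  have inner: "(LINT x|?O. f \<theta> x) = F \<theta> \<bullet> (LINT y|lborel. \<delta> y *\<^sub>R w (X \<theta> + y))" for \<theta>
  proof -
    have "(LINT x|?O. f \<theta> x) = (LINT y|lborel. f \<theta> (X \<theta> + y))"
      by (rule lebesgue_on_integral_translate[OF \<Omega>L]) (auto simp: f_def w(2))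
    also have "\<dots> = (LINT y|lborel. F \<theta> \<bullet> (\<delta> y *\<^sub>R w (X \<theta> + y)))"
      by (simp add: f_def)
    also have "\<dots> = F \<theta> \<bullet> (LINT y|lborel. \<delta> y *\<^sub>R w (X \<theta> + y))"
    proof (rule integral_inner_right)
      show "integrable lborel (\<lambda>y. \<delta> y *\<^sub>R w (X \<theta> + y))"
        using \<delta>(2)
        by (intro compact_support_integrable[of _ R] continuous_intros \<delta>(1) continuous_on_compose2[OF w(1)]) auto
    qed
    finally show ?thesis .
  qed
  have int1: "integrable ?T (\<lambda>\<theta>. F \<theta> \<bullet> w (X \<theta>))"
  proof (rule Bochner_Integration.integrable_bound)
    show "integrable ?T (\<lambda>\<theta>. norm (F \<theta>) * S)" using F by auto
    show "AE \<theta> in ?T. norm (F \<theta> \<bullet> w (X \<theta>)) \<le> norm (norm (F \<theta>) * S)"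
    proof (rule AE_I2)
      fix \<theta>
      have "norm (F \<theta> \<bullet> w (X \<theta>)) \<le> norm (F \<theta>) * norm (w (X \<theta>))"
        using Cauchy_Schwarz_ineq2 by simp
      also have "\<dots> \<le> norm (F \<theta>) * S" by (intro mult_left_mono S) simp
      finally show "norm (F \<theta> \<bullet> w (X \<theta>)) \<le> norm (norm (F \<theta>) * S)" by simp
    qed
  qed measurable
  have int2: "integrable ?T (\<lambda>\<theta>. F \<theta> \<bullet> (LINT y|lborel. \<delta> y *\<^sub>R w (X \<theta> + y)))"
    using integrable_fst[OF f_int] by (simp add: inner)
  have E: "F \<theta> \<bullet> E (X \<theta>) = F \<theta> \<bullet> w (X \<theta>) - F \<theta> \<bullet> (LINT y|lborel. \<delta> y *\<^sub>R w (X \<theta> + y))" for \<theta>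
    by (simp add: E_def inner_diff_right)
  show "integrable ?T (\<lambda>\<theta>. F \<theta> \<bullet> E (X \<theta>))" unfolding E using int1 int2 by auto
  have "force \<Omega> \<Theta> X F \<phi> = (LINT \<theta>|?T. F \<theta> \<bullet> w (X \<theta>))"
    unfolding force_def using X(2) w(3) by (intro Bochner_Integration.integral_cong) auto
  moreover have "functional_of \<Omega> (reg_force \<Theta> X F \<delta>) \<phi> = (LINT x|?O. LINT \<theta>|?T. f \<theta> x)"
  proof -
    have eq: "reg_force \<Theta> X F \<delta> x \<bullet> w x = (LINT \<theta>|?T. f \<theta> x)" for x
      unfolding reg_force_def f_def using integral_inner_left[OF f_slice[of x], of "w x"] by simp
    have [measurable]: "reg_force \<Theta> X F \<delta> \<in> borel_measurable ?O"
      unfolding reg_force_def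
    proof (rule T.borel_measurable_lebesgue_integral)
      have [measurable]: "(\<lambda>z. fst z) \<in> measurable (?O \<Otimes>\<^sub>M ?T) borel"
        by (rule measurable_compose[OF measurable_fst \<open>(\<lambda>x. x) \<in> measurable ?O borel\<close>])
      have [measurable]: "(\<lambda>z. X (snd z)) \<in> measurable (?O \<Otimes>\<^sub>M ?T) borel"
        by (rule measurable_compose[OF measurable_snd X(1)])
      have [measurable]: "(\<lambda>z. F (snd z)) \<in> measurable (?O \<Otimes>\<^sub>M ?T) borel"
        by (rule measurable_compose[OF measurable_snd \<open>F \<in> borel_measurable ?T\<close>])
      show "(\<lambda>(x, \<theta>). \<delta> (x - X \<theta>) *\<^sub>R F \<theta>) \<in> borel_measurable (?O \<Otimes>\<^sub>M ?T)"
        unfolding split_beta by measurable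
    qed
    have [measurable]: "w \<in> borel_measurable ?O"
      using measurable_compose[OF \<open>(\<lambda>x. x) \<in> measurable ?O borel\<close> \<open>w \<in> borel_measurable borel\<close>] .
    have "functional_of \<Omega> (reg_force \<Theta> X F \<delta>) \<phi> = (LINT x|?O. reg_force \<Theta> X F \<delta> x \<bullet> w x)"
      unfolding functional_of_def using \<phi>(2) by (intro integral_cong_AE) (auto elim!: eventually_mono)
    then show ?thesis by (simp add: eq)
  qed
  moreover have "(LINT x|?O. LINT \<theta>|?T. f \<theta> x) = (LINT \<theta>|?T. LINT x|?O. f \<theta> x)"
    by (rule Fubini_integral[OF f_int])
  ultimately show "force \<Omega> \<Theta> X F \<phi> - functional_of \<Omega> (reg_force \<Theta> X F \<delta>) \<phi> = (LINT \<theta>|?T. F \<theta> \<bullet> E (X \<theta>))"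
    unfolding E inner using int1 int2 by simp
qed

lemma polyhedral_domain_open_bounded:
  assumes "polyhedral_domain \<Omega>"
  shows "open \<Omega>" "bounded \<Omega>"
proof -
  obtain \<T> where \<T>: "finite \<T>" "\<forall>T\<in>\<T>. polytope T" "\<Omega> = interior (\<Union>\<T>)"
    using assms unfolding polyhedral_domain_def by blast
  show "open \<Omega>" using \<T>(3) by simp
  have "bounded (\<Union>\<T>)" using \<T> polytope_imp_bounded by (intro bounded_Union) auto
  then show "bounded \<Omega>" using \<T>(3) interior_subset bounded_subset by metis
qed

lemma C1_on_imp_continuous_on: "C1_on f S \<Longrightarrow> continuous_on S f"
  unfolding C1_on_def
  by (metis continuous_at_imp_continuous_on has_derivative_continuous subsetD)

section \<open>The error estimate\<close>

theorem proposition3: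
  fixes \<Omega> :: "(real^'n) set" and \<Theta> :: "(real^'m) set"
  assumes "CARD('n) \<in> {2, 3}" and "CARD('m) = CARD('n) - 1"
    and "polyhedral_domain \<Omega>"
    and "bounded \<Theta>" and "\<Theta> \<in> sets lebesgue"
  shows "\<exists>C\<^sub>0 :: real \<Rightarrow> ennreal \<Rightarrow> real. (\<forall>p J. C\<^sub>0 p J > 0) \<and>
    (\<forall>p (X :: real^'m \<Rightarrow> real^'n).
       1 \<le> p \<and> p < real CARD('n) / (real CARD('n) - 1) \<and> immersed_boundary \<Omega> \<Theta> X \<longrightarrow>
       (\<forall>F \<epsilon> K (\<delta> :: real^'n \<Rightarrow> real).
          F \<in> Lp_space (ennreal p) (lebesgue_on \<Theta>) \<and> \<epsilon> > 0 \<and> K > 0 \<and>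
          continuous_on UNIV \<delta> \<and> closure {y. \<delta> y \<noteq> 0} \<subseteq> ball 0 (K * \<epsilon>) \<longrightarrow>
          Wneg1_norm p \<Omega>
            (\<lambda>\<phi>. force \<Omega> \<Theta> X F \<phi> - functional_of \<Omega> (reg_force \<Theta> X F \<delta>) \<phi>)
          \<le> ennreal (C\<^sub>0 p (Linf_norm (lebesgue_on \<Theta>) (surface_factor X)) *
              Lp_norm (ennreal p) (lebesgue_on \<Theta>) F *
              (\<bar>1 - (LINT y|lborel. \<delta> y)\<bar> +
               Lp_norm (ennreal p) lborel (\<lambda>y. \<delta> y *\<^sub>R y)))))"
proof -
  have \<Omega>: "open \<Omega>" "bounded \<Omega>" using polyhedral_domain_open_bounded assms(3) by blast+
  have \<Theta>: "finite_measure (lebesgue_on \<Theta>)"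
    using assms(4,5) by (intro finite_measure_lebesgue_on bounded_set_imp_lmeasurable)
  obtain r where r: "r > 0" "\<And>x. x \<in> \<Omega> \<Longrightarrow> norm x \<le> r" using \<Omega>(2) unfolding bounded_pos by blast
  \<comment> \<open>Long enough that \<open>x + y\<close> leaves the ball of radius \<open>r\<close> whenever \<open>x\<close> is in it and \<open>y\<close> is within distance \<open>1\<close> of \<open>c\<close>.\<close>
  define c :: "real^'n" where "c = (2 * r + 2) *\<^sub>R axis undefined 1"
  have c: "x + y \<notin> \<Omega>" if "x \<in> \<Omega>" "y \<in> ball c 1" for x y
  proof
    assume "x + y \<in> \<Omega>"
    have "norm c = 2 * r + 2" using r by (simp add: c_def norm_axis_1)
    moreover have "norm c - norm y < 1"
      using that(2) norm_triangle_ineq2[of c y] by (simp add: dist_norm)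
    moreover have "norm y \<le> norm (x + y) + norm x"
      using norm_triangle_ineq4[of "x + y" x] by simp
    ultimately show False using r(2)[OF that(1)] r(2)[OF \<open>x + y \<in> \<Omega>\<close>] by simp
  qed
  define m where "m = measure (lebesgue_on \<Theta>) \<Theta> + 1"
  have m: "m \<ge> 1" by (simp add: m_def)
  define B where "B = (\<lambda>p. real CARD('n) * \<bar>sup_bound c p\<bar> +
    real CARD('n) * \<bar>real CARD('n) / (1 - real CARD('n) * (p - 1) / p)\<bar>)"
  have B: "B p \<ge> 0" for p by (simp add: B_def)
  have B_ge: "real CARD('n) * sup_bound c p \<le> B p"
      "real CARD('n) * (real CARD('n) / (1 - real CARD('n) * (p - 1) / p)) \<le> B p" for p
  proof -
    have le: "real CARD('n) * z \<le> real CARD('n) * \<bar>z\<bar>" "0 \<le> real CARD('n) * \<bar>z\<bar>" for z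
      by (auto intro: mult_left_mono)
    show "real CARD('n) * sup_bound c p \<le> B p"
      "real CARD('n) * (real CARD('n) / (1 - real CARD('n) * (p - 1) / p)) \<le> B p"
      unfolding B_def by (intro add_increasing add_increasing2 le)+
  qed
  have B_ge: "real CARD('n) * sup_bound c p \<le> B p"
      "real CARD('n) * (real CARD('n) / (1 - real CARD('n) * (p - 1) / p)) \<le> B p" for p
  proof -
    have le: "real CARD('n) * z \<le> real CARD('n) * \<bar>z\<bar>" "0 \<le> real CARD('n) * \<bar>z\<bar>" for z
      by (auto intro: mult_left_mono)
    show "real CARD('n) * sup_bound c p \<le> B p"
      "real CARD('n) * (real CARD('n) / (1 - real CARD('n) * (p - 1) / p)) \<le> B p"
      unfolding B_def by (intro add_increasing add_increasing2 le)+
  qed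
  have B_ge: "real CARD('n) * sup_bound c p \<le> B p"
      "real CARD('n) * (real CARD('n) / (1 - real CARD('n) * (p - 1) / p)) \<le> B p" for p
  proof -
    have le: "real CARD('n) * z \<le> real CARD('n) * \<bar>z\<bar>" "0 \<le> real CARD('n) * \<bar>z\<bar>" for z
      by (auto intro: mult_left_mono)
    show "real CARD('n) * sup_bound c p \<le> B p"
      "real CARD('n) * (real CARD('n) / (1 - real CARD('n) * (p - 1) / p)) \<le> B p"
      unfolding B_def by (intro add_increasing add_increasing2 le)+
  qed
  have B_ge: "real CARD('n) * sup_bound c p \<le> B p"
      "real CARD('n) * (real CARD('n) / (1 - real CARD('n) * (p - 1) / p)) \<le> B p" for p
  proof -
    have le: "real CARD('n) * z \<le> real CARD('n) * \<bar>z\<bar>" "0 \<le> real CARD('n) * \<bar>z\<bar>" for z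
      by (auto intro: mult_left_mono)
    show "real CARD('n) * sup_bound c p \<le> B p"
      "real CARD('n) * (real CARD('n) / (1 - real CARD('n) * (p - 1) / p)) \<le> B p"
      unfolding B_def by (intro add_increasing add_increasing2 le)+
  qed
  have B_ge: "real CARD('n) * sup_bound c p \<le> B p"
      "real CARD('n) * (real CARD('n) / (1 - real CARD('n) * (p - 1) / p)) \<le> B p" for p
  proof -
    have le: "real CARD('n) * z \<le> real CARD('n) * \<bar>z\<bar>" "0 \<le> real CARD('n) * \<bar>z\<bar>" for z
      by (auto intro: mult_left_mono)
    show "real CARD('n) * sup_bound c p \<le> B p"
      "real CARD('n) * (real CARD('n) / (1 - real CARD('n) * (p - 1) / p)) \<le> B p"
      unfolding B_def by (intro add_increasing add_increasing2 le)+
  qed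
  have B_ge: "real CARD('n) * sup_bound c p \<le> B p"
      "real CARD('n) * (real CARD('n) / (1 - real CARD('n) * (p - 1) / p)) \<le> B p" for p
  proof -
    have le: "real CARD('n) * z \<le> real CARD('n) * \<bar>z\<bar>" "0 \<le> real CARD('n) * \<bar>z\<bar>" for z
      by (auto intro: mult_left_mono)
    show "real CARD('n) * sup_bound c p \<le> B p"
      "real CARD('n) * (real CARD('n) / (1 - real CARD('n) * (p - 1) / p)) \<le> B p"
      unfolding B_def by (intro add_increasing add_increasing2 le)+
  qed
  have B_ge: "real CARD('n) * sup_bound c p \<le> B p"
      "real CARD('n) * (real CARD('n) / (1 - real CARD('n) * (p - 1) / p)) \<le> B p" for p
  proof -
    have le: "real CARD('n) * z \<le> real CARD('n) * \<bar>z\<bar>" "0 \<le> real CARD('n) * \<bar>z\<bar>" for z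
      by (auto intro: mult_left_mono)
    show "real CARD('n) * sup_bound c p \<le> B p"
      "real CARD('n) * (real CARD('n) / (1 - real CARD('n) * (p - 1) / p)) \<le> B p"
      unfolding B_def by (intro add_increasing add_increasing2 le)+
  qed
  \<comment> \<open>The summand \<open>1\<close> and the absolute values in \<open>B\<close> ensure positivity for every \<open>p\<close>, also outside the admissible range.\<close>
  define C0 where "C0 = (\<lambda>(p::real) (J::ennreal). m * B p + 1)"
  show ?thesis
  proof (intro exI[of _ C0] conjI allI impI)
    show "C0 p J > 0" for p J
      unfolding C0_def using m B[of p] by (intro add_nonneg_pos mult_nonneg_nonneg) auto
  next
    fix p \<epsilon> K and F X :: "real^'m \<Rightarrow> real^'n" and \<delta> :: "real^'n \<Rightarrow> real"
    assume "1 \<le> p \<and> p < real CARD('n) / (real CARD('n) - 1) \<and> immersed_boundary \<Omega> \<Theta> X"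
    then have p: "1 \<le> p" "p < real CARD('n) / (real CARD('n) - 1)" and X: "X ` \<Theta> \<subseteq> \<Omega>" "C1_on X \<Theta>"
      by (auto simp: immersed_boundary_def Let_def)
    assume "F \<in> Lp_space (ennreal p) (lebesgue_on \<Theta>) \<and> \<epsilon> > 0 \<and> K > 0 \<and>
          continuous_on UNIV \<delta> \<and> closure {y. \<delta> y \<noteq> 0} \<subseteq> ball 0 (K * \<epsilon>)"
    then have F: "F \<in> Lp_space (ennreal p) (lebesgue_on \<Theta>)" and \<delta>: "continuous_on UNIV \<delta>"
      and supp: "closure {y. \<delta> y \<noteq> 0} \<subseteq> ball 0 (K * \<epsilon>)" by auto
    have \<delta>0: "\<delta> y = 0" if "y \<notin> cball 0 (K * \<epsilon>)" for y
      using that supp closure_subset[of "{y. \<delta> y \<noteq> 0}"] by force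
    have s: "real CARD('n) * (p - 1) / p < 1"
      using assms(1) p by (auto simp: field_simps)
    have X_meas: "X \<in> borel_measurable (lebesgue_on \<Theta>)"
      using C1_on_imp_continuous_on[OF X(2)] assms(5) by (rule continuous_imp_measurable_on_sets_lebesgue)
    note F1 = L1_le_Lp_norm[OF \<Theta> p(1) F]
    define \<rho> where "\<rho> = \<bar>1 - (LINT y|lborel. \<delta> y)\<bar> + Lp_norm (ennreal p) lborel (\<lambda>y. \<delta> y *\<^sub>R y)"
    have \<rho>: "\<rho> \<ge> 0" unfolding \<rho>_def using Lp_norm_nonneg by (intro add_nonneg_nonneg) auto
    let ?L = "\<lambda>\<phi>. force \<Omega> \<Theta> X F \<phi> - functional_of \<Omega> (reg_force \<Theta> X F \<delta>) \<phi>"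
    have main: "\<bar>?L \<phi>\<bar> \<le> C0 p J * Lp_norm (ennreal p) (lebesgue_on \<Theta>) F * \<rho>"
      if \<phi>: "\<phi> \<in> W1_0 (conj_exponent p) \<Omega>" "W1_norm (conj_exponent p) \<Omega> \<phi> \<le> 1" for \<phi> J
    proof -
      obtain w :: "real^'n \<Rightarrow> real^'n" and G H where w:
        "continuous_on UNIV w" "\<And>x. x \<notin> \<Omega> \<Longrightarrow> w x = 0" "\<And>x. x \<in> \<Omega> \<Longrightarrow> cont_rep \<Omega> \<phi> x = w x"
        "\<phi> \<in> borel_measurable (lebesgue_on \<Omega>)" "AE x in lebesgue_on \<Omega>. \<phi> x = w x"
        "\<And>k i \<psi>. \<psi> \<in> test_functions \<Omega> \<Longrightarrow>
           (LINT x|lebesgue_on \<Omega>. w x $ k * partial_deriv i \<psi> x) = - (LINT x|lebesgue_on \<Omega>. G x $ k $ i * \<psi> x)"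
        "\<And>k i. AE x in lebesgue_on \<Omega>. \<bar>G x $ k $ i\<bar> \<le> H x"
        "H \<in> borel_measurable borel" "\<And>x. H x \<ge> 0" "conj_unit_bound p H"
        by (rule dual_unit_ball_zero_extension[OF \<Omega>(1) p(1) \<phi>]; (assumption | rule that; assumption))
      define E where "E = (\<lambda>x. w x - (LINT y|lborel. \<delta> y *\<^sub>R w (x + y)))"
      have E: "norm (E x) \<le> B p * \<rho>" for x
      proof -
        have "norm (E x) \<le> real CARD('n) * sup_bound c p * \<bar>1 - (LINT y|lborel. \<delta> y)\<bar> +
            real CARD('n) * (real CARD('n) / (1 - real CARD('n) * (p - 1) / p)) * Lp_norm (ennreal p) lborel (\<lambda>y. \<delta> y *\<^sub>R y)"
          unfolding E_def
          by (rule mollification_error_bound[OF \<Omega> w(1,2,6-9) p(1) s w(10) c \<delta> \<delta>0])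
        also have "\<dots> \<le> B p * \<bar>1 - (LINT y|lborel. \<delta> y)\<bar> + B p * Lp_norm (ennreal p) lborel (\<lambda>y. \<delta> y *\<^sub>R y)"
          by (intro add_mono mult_right_mono Lp_norm_nonneg B_ge) auto
        finally show ?thesis by (simp add: \<rho>_def distrib_left)
      qed
      note rep = force_difference_representation[OF \<Theta> \<Omega> X_meas X(1) F1(1) w(1-5) \<delta> \<delta>0]
      have "\<bar>?L \<phi>\<bar> = \<bar>LINT \<theta>|lebesgue_on \<Theta>. F \<theta> \<bullet> E (X \<theta>)\<bar>"
        unfolding E_def by (rule arg_cong[where f = abs, OF rep(2)])
      also have "\<dots> \<le> (LINT \<theta>|lebesgue_on \<Theta>. norm (F \<theta>) * (B p * \<rho>))"
      proof (rule integral_abs_bound_integral)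
        show "integrable (lebesgue_on \<Theta>) (\<lambda>\<theta>. F \<theta> \<bullet> E (X \<theta>))"
          unfolding E_def by (rule rep(1))
        show "integrable (lebesgue_on \<Theta>) (\<lambda>\<theta>. norm (F \<theta>) * (B p * \<rho>))" using F1(1) by auto
        show "\<bar>F \<theta> \<bullet> E (X \<theta>)\<bar> \<le> norm (F \<theta>) * (B p * \<rho>)" for \<theta>
          by (rule order_trans[OF Cauchy_Schwarz_ineq2]) (intro mult_left_mono E norm_ge_zero)
      qed
      also have "\<dots> = (LINT \<theta>|lebesgue_on \<Theta>. norm (F \<theta>)) * (B p * \<rho>)" by simp
      also have "\<dots> \<le> (m * Lp_norm (ennreal p) (lebesgue_on \<Theta>) F) * (B p * \<rho>)"
        using F1(2) B[of p] \<rho> unfolding m_def by (intro mult_right_mono) auto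
      also have "\<dots> = (m * B p) * (Lp_norm (ennreal p) (lebesgue_on \<Theta>) F * \<rho>)" by (simp add: mult_ac)
      also have "\<dots> \<le> C0 p J * (Lp_norm (ennreal p) (lebesgue_on \<Theta>) F * \<rho>)"
        unfolding C0_def using \<rho> Lp_norm_nonneg by (intro mult_right_mono mult_nonneg_nonneg) auto
      finally show ?thesis by (simp add: mult.assoc)
    qed
    show "Wneg1_norm p \<Omega> ?L \<le> ennreal (C0 p (Linf_norm (lebesgue_on \<Theta>) (surface_factor X)) *
              Lp_norm (ennreal p) (lebesgue_on \<Theta>) F *
              (\<bar>1 - (LINT y|lborel. \<delta> y)\<bar> + Lp_norm (ennreal p) lborel (\<lambda>y. \<delta> y *\<^sub>R y)))"
      unfolding Wneg1_norm_def \<rho>_def[symmetric]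
      using main by (intro SUP_least ennreal_leI) auto
  qed
qed

end
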